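(* Let $R \subset \Delta$ be the Rauzy gasket, that is, the unique non-empty compact subset of the standard $2$-simplex $\Delta$ satisfying $R = f_1(R)\cup f_2(R)\cup f_3(R)$, where $f_1, f_2, f_3$ are the projective maps of $\Delta$ defined in the context. Then its Hausdorff dimension satisfies $$\dim_{\mathrm{H}}(R) > 1.19.$$
   Context: Let $\Delta = \{(x_1,x_2,x_3)\in\mathbb{R}^3 : x_1,x_2,x_3\geq 0,\ x_1+x_2+x_3=1\}$ be the (closed) standard $2$-simplex, and for $j\in\{1,2,3\}$ let $\Delta_j = \{(x_1,x_2,x_3)\in\Delta : x_j\geq \sum_{k\neq j}x_k\}$. Consider the matrices $$M_1 = \begin{pmatrix} 1 & 1 & 1 \\ 0 & 1 & 0 \\ 0 & 0 & 1\end{pmatrix},\quad M_2 = \begin{pmatrix} 1 & 0 & 0 \\ 1 & 1 & 1 \\ 0 & 0 & 1\end{pmatrix},\quad M_3 = \begin{pmatrix} 1 & 0 & 0 \\ 0 & 1 & 0 \\ 1 & 1 & 1\end{pmatrix}.$$ For $j\in\{1,2,3\}$, the map $f_j\colon \Delta\to\Delta_j$ is the projectivization of $M_j$ acting on column vectors: $f_j(x) = M_j x/\|M_j x\|_1$, where $\|y\|_1 = y_1+y_2+y_3$ for $y$ with non-negative entries. (For instance, $f_1(x_1,x_2,x_3) = \frac{1}{1+x_2+x_3}(1,x_2,x_3)$ for $(x_1,x_2,x_3)\in\Delta$.) It is a known fact that there is a unique non-empty compact set $R\subset\Delta$ with $R = f_1(R)\cup f_2(R)\cup f_3(R)$; it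 is called the Rauzy gasket. $\dim_{\mathrm{H}}$ denotes Hausdorff dimension with respect to the Euclidean metric on $\Delta\subset\mathbb{R}^3$. *)

theory Defs
  imports "HOL-Analysis.Analysis"
begin

section \<open>Hausdorff measure and Hausdorff dimension\<close>

text \<open>
  The summand \<open>(diam U)\<^sup>s\<close>, with the usual conventions \<open>0\<^sup>0 = 1\<close> for a
  nonempty set and value \<open>0\<close> for the empty set. The case \<open>s = 0\<close> is separate because
  \<^term>\<open>0 powr 0 = (0::real)\<close> in Isabelle.
\<close>
definition diam_pow :: "real \<Rightarrow> 'a::metric_space set \<Rightarrow> ennreal" where
  "diam_pow s U = (if U = {} then 0 else if s = 0 then 1 else ennreal (diameter U powr s))"

text \<open>
  Covers are sequences of sets; finite covers are included since sets may be empty.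
  Boundedness is required explicitly because \<^term>\<open>diameter\<close> is real-valued and carries no
  information on unbounded sets.
\<close>
definition hausdorff_premeasure :: "real \<Rightarrow> real \<Rightarrow> 'a::metric_space set \<Rightarrow> ennreal" where
  "hausdorff_premeasure s \<delta> A =
     (INF U \<in> {U :: nat \<Rightarrow> 'a set. A \<subseteq> (\<Union>i. U i) \<and> (\<forall>i. bounded (U i) \<and> diameter (U i) \<le> \<delta>)}.
        \<Sum>i. diam_pow s (U i))"

definition hausdorff_measure :: "real \<Rightarrow> 'a::metric_space set \<Rightarrow> ennreal" where
  "hausdorff_measure s A = (SUP \<delta>\<in>{0<..}. hausdorff_premeasure s \<delta> A)"

definition hausdorff_dim :: "'a::metric_space set \<Rightarrow> ereal" where
  "hausdorff_dim A = Inf {ereal s |s. 0 \<le> s \<and> hausdorff_measure s A = 0}"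


section \<open>The Rauzy gasket\<close>

definition std_simplex :: "(real^3) set" where
  "std_simplex = {x. (\<forall>i. 0 \<le> x $ i) \<and> (\<Sum>i\<in>UNIV. x $ i) = 1}"

definition rauzy_matrix :: "3 \<Rightarrow> real^3^3" where
  "rauzy_matrix j =
    (if j = 1 then vector [vector [1, 1, 1],
                           vector [0, 1, 0],
                           vector [0, 0, 1]]
     else if j = 2 then vector [vector [1, 0, 0],
                                vector [1, 1, 1],
                                vector [0, 0, 1]]
     else vector [vector [1, 0, 0],
                  vector [0, 1, 0],
                  vector [1, 1, 1]])"

definition l1_norm :: "real^3 \<Rightarrow> real" where
  "l1_norm y = (\<Sum>i\<in>UNIV. \<bar>y $ i\<bar>)"

definition rauzy_map :: "3 \<Rightarrow> real^3 \<Rightarrow> real^3" where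
  "rauzy_map j x = (1 / l1_norm (rauzy_matrix j *v x)) *\<^sub>R (rauzy_matrix j *v x)"

definition is_rauzy_gasket :: "(real^3) set \<Rightarrow> bool" where
  "is_rauzy_gasket R \<longleftrightarrow> R \<noteq> {} \<and> compact R \<and> R \<subseteq> std_simplex \<and>
     R = rauzy_map 1 ` R \<union> rauzy_map 2 ` R \<union> rauzy_map 3 ` R"

text \<open>The description is justified by \<open>rauzy_gasket_ex1\<close> below.\<close>
definition rauzy_gasket :: "(real^3) set" where
  "rauzy_gasket = (THE R. is_rauzy_gasket R)"


section \<open>Existence and uniqueness of the gasket\<close>

lemma rauzy_map_nth:
  assumes "x \<in> std_simplex"
  shows "rauzy_map j x $ i = (if i = j then 1 else x $ i) / (2 - x $ j)"
proof -
  have s: "x$1 + x$2 + x$3 = 1" and nn: "0 \<le> x$1" "0 \<le> x$2" "0 \<le> x$3"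
    using assms by (auto simp: std_simplex_def sum_3)
  consider "j = 1" | "j = 2" | "j = 3" using exhaust_3 by blast
  then show ?thesis
  proof cases
    case 1
    have "l1_norm (rauzy_matrix j *v x) = 2 - x $ j"
      using s nn by (simp add: 1 l1_norm_def rauzy_matrix_def sum_3 matrix_vector_mult_def)
    then show ?thesis using exhaust_3[of i] s
      by (auto simp: 1 rauzy_map_def rauzy_matrix_def sum_3 matrix_vector_mult_def)
  next
    case 2
    have "l1_norm (rauzy_matrix j *v x) = 2 - x $ j"
      using s nn by (simp add: 2 l1_norm_def rauzy_matrix_def sum_3 matrix_vector_mult_def)
    then show ?thesis using exhaust_3[of i] s
      by (auto simp: 2 rauzy_map_def rauzy_matrix_def sum_3 matrix_vector_mult_def)
  next
    case 3
    have "l1_norm (rauzy_matrix j *v x) = 2 - x $ j"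
      using s nn by (simp add: 3 l1_norm_def rauzy_matrix_def sum_3 matrix_vector_mult_def)
    then show ?thesis using exhaust_3[of i] s
      by (auto simp: 3 rauzy_map_def rauzy_matrix_def sum_3 matrix_vector_mult_def)
  qed
qed

lemma std_simplex_le_1: "x \<in> std_simplex \<Longrightarrow> x $ i \<le> 1"
  using exhaust_3[of i] unfolding std_simplex_def sum_3
  by (auto, (smt (verit, best))+)

lemma rauzy_map_in_simplex:
  assumes "x \<in> std_simplex"
  shows "rauzy_map j x \<in> std_simplex"
proof -
  have s: "x$1 + x$2 + x$3 = 1" and nn: "\<And>i. 0 \<le> x$i"
    using assms by (auto simp: std_simplex_def sum_3)
  have p: "0 < 2 - x$j" using std_simplex_le_1[OF assms, of j] by linarith
  have "(\<Sum>i\<in>UNIV. rauzy_map j x $ i) = 1"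
    using exhaust_3[of j] s p
    by (auto simp: rauzy_map_nth[OF assms] sum_3 add_divide_distrib[symmetric])
  then show ?thesis using nn p by (auto simp: std_simplex_def rauzy_map_nth[OF assms])
qed

lemma compact_std_simplex: "compact std_simplex"
proof -
  have "std_simplex = (\<Inter>i. {x::real^3. 0 \<le> x $ i}) \<inter> {x. (\<Sum>i\<in>UNIV. x $ i) = 1}"
    by (auto simp: std_simplex_def)
  also have "closed \<dots>"
    by (intro closed_Int closed_INT ballI closed_Collect_le closed_Collect_eq continuous_intros)
  finally have "closed std_simplex" .
  moreover have "std_simplex \<subseteq> cbox 0 1"
    using std_simplex_le_1 by (auto simp: mem_box_cart std_simplex_def)
  ultimately show ?thesis
    by (metis bounded_cbox bounded_subset compact_eq_bounded_closed)
qed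

lemma continuous_on_rauzy_map: "continuous_on std_simplex (rauzy_map j)"
proof -
  have "continuous_on std_simplex (\<lambda>x. \<chi> i. (if i = j then 1 else x $ i) / (2 - x $ j))"
  proof (rule continuous_on_vec_lambda)
    fix i
    have "\<forall>x\<in>std_simplex. 2 - x $ j \<noteq> 0" using std_simplex_le_1[of _ j] by fastforce
    then show "continuous_on std_simplex (\<lambda>x. (if i = j then 1 else x $ i) / (2 - x $ j))"
      by (cases "i = j") (auto intro!: continuous_intros)
  qed
  then show ?thesis
    by (rule continuous_on_eq) (simp add: vec_eq_iff rauzy_map_nth)
qed

lemma contraction_aux:
  fixes b c b' c' m :: real
  assumes "0 \<le> b" "0 \<le> c" "0 \<le> b'" "0 \<le> c'" "0 < b' + c'" "0 < m"
    and "\<bar>b - b'\<bar> \<le> m" "\<bar>c - c'\<bar> \<le> m" "\<bar>(b + c) - (b' + c')\<bar> \<le> m"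
  shows "\<bar>b / (1 + b + c) - b' / (1 + b' + c')\<bar> < m"
    and "\<bar>1 / (1 + b + c) - 1 / (1 + b' + c')\<bar> < m"
proof -
  define P where "P = (1 + b + c) * (1 + b' + c')"
  have P: "0 < P" using assms by (simp add: P_def)
  have "(1 + b + c) * 1 < (1 + b + c) * (1 + b' + c')"
    using assms by (intro mult_strict_left_mono) auto
  then have mP: "m * (1 + b + c) < m * P"
    using assms by (simp add: P_def)
  have eq: "b / (1 + b + c) - b' / (1 + b' + c') = ((b - b') * (1 + c) - b * (c - c')) / P"
    using assms by (simp add: P_def divide_simps) (auto simp: algebra_simps)
  have "\<bar>(b - b') * (1 + c) - b * (c - c')\<bar> \<le> \<bar>b - b'\<bar> * (1 + c) + b * \<bar>c - c'\<bar>"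
    using assms abs_triangle_ineq4[of "(b - b') * (1 + c)" "b * (c - c')"] by (simp add: abs_mult)
  also have "\<dots> \<le> m * (1 + c) + b * m"
    using assms by (intro add_mono mult_mono) auto
  also have "\<dots> = m * (1 + b + c)" by (simp add: algebra_simps)
  also note mP
  finally show "\<bar>b / (1 + b + c) - b' / (1 + b' + c')\<bar> < m"
    unfolding eq using P by (simp add: divide_less_eq)
  have "1 / (1 + b + c) - 1 / (1 + b' + c') = ((b' + c') - (b + c)) / P"
    using assms by (simp add: P_def divide_simps)
  also have "\<bar>\<dots>\<bar> = \<bar>(b + c) - (b' + c')\<bar> / P" using P by (simp add: abs_minus_commute)
  also have "\<dots> \<le> m / P" using assms P by (simp add: divide_right_mono)
  also have "\<dots> < m"
  proof -
    have "m * 1 \<le> m * (1 + b + c)" using assms by (intro mult_left_mono) auto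
    then show ?thesis using mP P by (simp add: divide_less_eq)
  qed
  finally show "\<bar>1 / (1 + b + c) - 1 / (1 + b' + c')\<bar> < m" .
qed

lemma contraction_coord:
  fixes a b c a' b' c' m :: real
  assumes "0 \<le> b" "0 \<le> c" "0 \<le> b'" "0 \<le> c'" "a + b + c = 1" "a' + b' + c' = 1" "0 < m"
    and "\<bar>a - a'\<bar> \<le> m" "\<bar>b - b'\<bar> \<le> m" "\<bar>c - c'\<bar> \<le> m" "b \<noteq> b' \<or> c \<noteq> c'"
  shows "\<bar>b / (2 - a) - b' / (2 - a')\<bar> < m" "\<bar>1 / (2 - a) - 1 / (2 - a')\<bar> < m"
proof -
  have eq: "2 - a = 1 + b + c" "2 - a' = 1 + b' + c'" using assms by auto
  have st: "\<bar>(b + c) - (b' + c')\<bar> \<le> m" using assms by linarith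
  consider "0 < b' + c'" | "0 < b + c" using assms by linarith
  then have "\<bar>b / (2 - a) - b' / (2 - a')\<bar> < m \<and> \<bar>1 / (2 - a) - 1 / (2 - a')\<bar> < m"
  proof cases
    case 1
    then show ?thesis unfolding eq using contraction_aux[of b c b' c' m] assms st by blast
  next
    case 2
    then show ?thesis unfolding eq
      using contraction_aux[of b' c' b c m] assms st by (simp add: abs_minus_commute)
  qed
  then show "\<bar>b / (2 - a) - b' / (2 - a')\<bar> < m" "\<bar>1 / (2 - a) - 1 / (2 - a')\<bar> < m" by auto
qed

lemma third_index: "\<exists>l::3. l \<noteq> i \<and> l \<noteq> j"
proof (rule ccontr)
  assume "\<not> ?thesis"
  then have "(UNIV :: 3 set) \<subseteq> {i, j}" by blast
  then have "card (UNIV :: 3 set) \<le> card {i, j}" by (intro card_mono) auto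
  also have "\<dots> \<le> 2" by (simp add: card_insert_if)
  finally show False by simp
qed

lemma infnorm_3: "infnorm (z :: real^3) = Max {\<bar>z$1\<bar>, \<bar>z$2\<bar>, \<bar>z$3\<bar>}"
proof -
  have "{\<bar>z $ i\<bar> |i. i \<in> (UNIV :: 3 set)} = {\<bar>z$1\<bar>, \<bar>z$2\<bar>, \<bar>z$3\<bar>}"
    by (auto simp: UNIV_3)
  then show ?thesis by (simp add: infnorm_cart cSup_eq_Max)
qed

lemma rauzy_map_contractive:
  assumes x: "x \<in> std_simplex" and y: "y \<in> std_simplex" and ne: "x \<noteq> y"
  shows "infnorm (rauzy_map j x - rauzy_map j y) < infnorm (x - y)"
proof -
  define m where "m = infnorm (x - y)"
  have m: "0 < m" using ne by (simp add: m_def infnorm_pos_lt)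
  have le: "\<bar>x$i - y$i\<bar> \<le> m" for i
    unfolding m_def using component_le_infnorm_cart[of "x - y" i] by simp
  have sx: "x$1 + x$2 + x$3 = 1" "\<And>i. 0 \<le> x$i" and sy: "y$1 + y$2 + y$3 = 1" "\<And>i. 0 \<le> y$i"
    using x y by (auto simp: std_simplex_def sum_3)
  have ne': "x$1 \<noteq> y$1 \<or> x$2 \<noteq> y$2 \<or> x$3 \<noteq> y$3"
    using ne by (auto simp: vec_eq_iff forall_3)
  have key: "\<bar>x$k / (2 - x$j) - y$k / (2 - y$j)\<bar> < m" "\<bar>1 / (2 - x$j) - 1 / (2 - y$j)\<bar> < m"
    if "j \<noteq> k" "j \<noteq> l" "k \<noteq> l" for k l
  proof -
    have U: "{j, k, l} = UNIV"
      using that exhaust_3 by (intro card_eq_UNIV_imp_eq_UNIV) auto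
    have "(\<Sum>i\<in>{j,k,l}. x$i) = 1" "(\<Sum>i\<in>{j,k,l}. y$i) = 1"
      unfolding U using sx sy by (auto simp: sum_3)
    then have s: "x$j + x$k + x$l = 1" "y$j + y$k + y$l = 1" using that by auto
    have "x$i \<noteq> y$i" if "x$k = y$k" "x$l = y$l" "x$j \<noteq> y$j" for i using that s by auto
    moreover have "\<exists>i\<in>{j,k,l}. x$i \<noteq> y$i" unfolding U using ne' by blast
    ultimately have n: "x$k \<noteq> y$k \<or> x$l \<noteq> y$l" using s by auto
    show "\<bar>x$k / (2 - x$j) - y$k / (2 - y$j)\<bar> < m" "\<bar>1 / (2 - x$j) - 1 / (2 - y$j)\<bar> < m"
      using contraction_coord[of "x$k" "x$l" "y$k" "y$l" "x$j" "y$j" m] sx(2) sy(2) s m le n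
      by auto
  qed
  have "\<bar>(rauzy_map j x - rauzy_map j y) $ i\<bar> < m" for i
  proof (cases "i = j")
    case True
    obtain k l where "j \<noteq> k" "j \<noteq> l" "k \<noteq> l"
      using third_index[of j j] third_index by metis
    then show ?thesis using key(2) True by (simp add: rauzy_map_nth x y)
  next
    case False
    obtain l where "j \<noteq> l" "i \<noteq> l" using third_index by metis
    then show ?thesis using key(1)[of i l] False by (simp add: rauzy_map_nth x y)
  qed
  then show ?thesis unfolding m_def[symmetric] infnorm_3[of "rauzy_map j x - rauzy_map j y"] by simp
qed

lemma rauzy_gasket_unique:
  assumes A: "is_rauzy_gasket A" and B: "is_rauzy_gasket B"
  shows "A \<subseteq> B"
proof (rule ccontr)
  assume "\<not> A \<subseteq> B"
  have cA: "compact A" "A \<noteq> {}" "A \<subseteq> std_simplex"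
    and cB: "compact B" "B \<noteq> {}" "B \<subseteq> std_simplex"
    using A B by (auto simp: is_rauzy_gasket_def)
  have A': "\<exists>j. \<exists>a'\<in>A. a = rauzy_map j a'" if "a \<in> A" for a
    using A that unfolding is_rauzy_gasket_def by blast
  have B': "rauzy_map j b \<in> B" if "b \<in> B" for b j
    using B that exhaust_3[of j] unfolding is_rauzy_gasket_def by blast
  have ci: "continuous_on S (\<lambda>y. infnorm (x - y))" for x :: "real^3" and S
    by (intro continuous_on_infnorm continuous_intros)
  define h where "h x = (INF y\<in>B. infnorm (x - y))" for x :: "real^3"
  have bdd: "bdd_below ((\<lambda>y. infnorm (x - y)) ` B)" for x :: "real^3"
    by (rule bdd_belowI[of _ 0]) (auto simp: infnorm_pos_le)
  have hle: "h x \<le> infnorm (x - y)" if "y \<in> B" for x y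
    unfolding h_def by (rule cINF_lower[OF bdd that])
  have hatt: "\<exists>y\<in>B. h x = infnorm (x - y)" for x
  proof -
    obtain y where y: "y \<in> B" "\<forall>z\<in>B. infnorm (x - y) \<le> infnorm (x - z)"
      using continuous_attains_inf[OF cB(1,2) ci] by blast
    then have "infnorm (x - y) \<le> h x" unfolding h_def by (intro cINF_greatest[OF cB(2)]) auto
    then show ?thesis using y hle[of y x] by force
  qed
  have lip: "h x \<le> h y + norm (x - y)" for x y
  proof -
    obtain z where z: "z \<in> B" "h y = infnorm (y - z)" using hatt by blast
    have "h x \<le> infnorm ((x - y) + (y - z))" using hle[OF z(1), of x] by simp
    also have "\<dots> \<le> infnorm (x - y) + infnorm (y - z)" by (rule infnorm_triangle)
    also have "\<dots> \<le> norm (x - y) + h y" using infnorm_le_norm[of "x - y"] z by simp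
    finally show ?thesis by simp
  qed
  have "continuous_on A h"
    unfolding continuous_on_iff
  proof (intro ballI allI impI)
    fix x and e :: real assume "0 < e"
    have "dist (h y) (h x) \<le> dist y x" for y
      using lip[of x y] lip[of y x] by (auto simp: dist_norm norm_minus_commute abs_le_iff)
    then show "\<exists>d>0. \<forall>x'\<in>A. dist x' x < d \<longrightarrow> dist (h x') (h x) < e"
      using \<open>0 < e\<close> by (meson le_less_trans)
  qed
  then obtain a where a: "a \<in> A" "\<forall>x\<in>A. h x \<le> h a"
    using continuous_attains_sup[OF cA(1,2)] by blast
  obtain x where x: "x \<in> A" "x \<notin> B" using \<open>\<not> A \<subseteq> B\<close> by blast
  have "0 < h x"
    using hatt[of x] x by (metis infnorm_pos_lt right_minus_eq)
  then have pos: "0 < h a" using a x by force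
  obtain j a' where a': "a' \<in> A" "a = rauzy_map j a'" using A'[OF a(1)] by blast
  obtain b where b: "b \<in> B" "h a' = infnorm (a' - b)" using hatt by blast
  have le: "h a \<le> infnorm (rauzy_map j a' - rauzy_map j b)"
    using hle[OF B'[OF b(1)]] a' by simp
  show False
  proof (cases "a' = b")
    case True
    then show False using le pos by (simp add: infnorm_0)
  next
    case False
    then have "infnorm (rauzy_map j a' - rauzy_map j b) < h a'"
      using rauzy_map_contractive[of a' b j] a' b cA cB by auto
    then show False using le a a' by force
  qed
qed

lemma rauzy_gasket_exists: "\<exists>R. is_rauzy_gasket R"
proof -
  define F where "F X = rauzy_map 1 ` X \<union> rauzy_map 2 ` X \<union> rauzy_map 3 ` X" for X
  define K where "K n = (F ^^ n) std_simplex" for n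
  have K0: "K 0 = std_simplex" and KS: "\<And>n. K (Suc n) = F (K n)" by (auto simp: K_def)
  have mono: "F X \<subseteq> F Y" if "X \<subseteq> Y" for X Y using that by (auto simp: F_def)
  have "F std_simplex \<subseteq> std_simplex" by (auto simp: F_def rauzy_map_in_simplex)
  then have step: "K (Suc n) \<subseteq> K n" for n
    by (induction n) (auto simp: K0 KS intro: mono[THEN subsetD])
  then have dec: "K n \<subseteq> K m" if "m \<le> n" for m n using lift_Suc_antimono_le[of K] that by blast
  have sub: "K n \<subseteq> std_simplex" for n using dec[of 0 n] K0 by simp
  have comp: "compact (K n)" for n
  proof (induction n)
    case 0 then show ?case by (simp add: K0 compact_std_simplex)
  next
    case (Suc n)
    then show ?case unfolding KS F_def
      using continuous_on_subset[OF continuous_on_rauzy_map sub]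
      by (intro compact_Un compact_continuous_image)
  qed
  have "axis 1 1 \<in> std_simplex" by (auto simp: std_simplex_def axis_def)
  then have ne: "K n \<noteq> {}" for n
    by (induction n) (auto simp: K0 KS F_def)
  define R where "R = (\<Inter>n. K n)"
  have "R \<noteq> {}" unfolding R_def using compact_nest[OF comp ne dec] by simp
  moreover have "compact R" unfolding R_def using comp by (intro compact_Inter) auto
  moreover have "R \<subseteq> std_simplex" using sub by (auto simp: R_def)
  moreover have "F R \<subseteq> R"
  proof -
    have "F R \<subseteq> K n" for n
      using mono[of R "K n"] step[of n] KS[of n] by (auto simp: R_def)
    then show ?thesis by (auto simp: R_def)
  qed
  moreover have "R \<subseteq> F R"
  proof
    fix y assume y: "y \<in> R"
    define L where "L n = (\<Union>j\<in>{1,2,3}. {x \<in> K n. rauzy_map j x \<in> {y}})" for n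
    have "compact (L n)" for n
      unfolding L_def
    proof (intro compact_UN)
      fix j :: 3
      have "closed (K n \<inter> rauzy_map j -` {y})"
        using continuous_on_subset[OF continuous_on_rauzy_map sub]
        by (intro continuous_closed_preimage compact_imp_closed comp) auto
      then have "compact (K n \<inter> (K n \<inter> rauzy_map j -` {y}))"
        using comp by (intro compact_Int_closed)
      also have "K n \<inter> (K n \<inter> rauzy_map j -` {y}) = {x \<in> K n. rauzy_map j x \<in> {y}}" by auto
      finally show "compact {x \<in> K n. rauzy_map j x \<in> {y}}" .
    qed auto
    moreover have "L n \<noteq> {}" for n
    proof -
      have "y \<in> F (K n)" using y KS[of n] by (auto simp: R_def)
      then show ?thesis by (auto simp: L_def F_def)
    qed
    moreover have "L n \<subseteq> L m" if "m \<le> n" for m n using dec[OF that] by (auto simp: L_def)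
    ultimately have "(\<Inter>n. L n) \<noteq> {}" using compact_nest[of L] by simp
    then obtain x where x: "\<And>n. x \<in> L n" by blast
    then have "x \<in> R" by (auto simp: R_def L_def)
    then show "y \<in> F R" using x[of 0] by (auto simp: F_def L_def)
  qed
  ultimately have "is_rauzy_gasket R"
    unfolding is_rauzy_gasket_def F_def[symmetric] by auto
  then show ?thesis ..
qed

theorem rauzy_gasket_ex1: "\<exists>!R. is_rauzy_gasket R"
  using rauzy_gasket_exists rauzy_gasket_unique by (metis subset_antisym)

lemma is_rauzy_gasket_rauzy_gasket: "is_rauzy_gasket rauzy_gasket"
  unfolding rauzy_gasket_def by (rule theI'[OF rauzy_gasket_ex1])

end

theory Submission
  imports Defs
begin

text \<open>
  A run of \<open>n\<close> equal letters followed by a change of letter acts on the gasket, up to a permutation of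
  coordinates, as one of two branches \<open>F\<close>: the \<open>n\<close>-th power of the first projective map followed by exchanging
  coordinate 1 with coordinate 2 or 3. Such a branch divides \<open>M x\<close> by the linear form \<open>l x = 1 + n * (1 - x\<^sub>1)\<close>.
  The branches contract in different directions by very different amounts, but in the maximum norm there is the clean
  estimate \<open>\<parallel>F x - F y\<parallel> \<ge> \<parallel>x - y\<parallel> / (l x * l y)\<close> (\<open>branch_expansion\<close>), for the following reason.
  The norm of \<open>x - y\<close> is the largest difference between two coordinates of the cross product of \<open>x\<close> and \<open>y\<close>. This
  cross product is transformed by the inverse transpose of \<open>M\<close> and divided by \<open>l x * l y\<close>, and the inverse transpose does
  not decrease that largest difference when the coordinates are not all of one strict sign. The lower bound for the contraction is
  therefore multiplicative along words, with local factor \<open>l\<^sup>-\<^sup>2\<close>.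

  Only the branches with \<open>n \<le> 40\<close> are used. On a compact part of the gasket their images are disjoint
  (\<open>branch_disjoint\<close>), and along every word the values of the product of the forms \<open>l\<close> differ by a bounded factor
  (\<open>word_ratio_distortion\<close>). For such a system the dimension is at least \<open>s\<close> as soon as there is a positive bounded
  function \<open>h\<close> whose sum of \<open>l\<^sup>-\<^sup>2\<^sup>s\<close> times \<open>h \<circ> F\<close> over the branches is at least \<open>h\<close>. This is proved by a direct
  induction over the pieces that a finite cover hits (\<open>finite_cover_bound\<close>).

  The function \<open>h x = 1/2 + x\<^sub>1\<close> satisfies the inequality for \<open>2 * s = 31/13\<close> (\<open>transfer_inequality\<close>). This exponent
  is a convenient fraction just above \<open>2.38\<close>, and \<open>31/26 > 1.19\<close>.
\<close>

section \<open>Iterated function systems with a subinvariant weight\<close>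

primrec word_map :: "('i \<Rightarrow> 'a \<Rightarrow> 'a) \<Rightarrow> 'i list \<Rightarrow> 'a \<Rightarrow> 'a" where
  "word_map F [] x = x"
| "word_map F (i # w) x = F i (word_map F w x)"

text \<open>
  The cocycle of \<open>\<rho>\<close> along a word. Words act with their last letter first, so appending a letter on
  the right refines the piece \<open>word_map F w ` K\<close>, while a new letter on the left applies one more map.
\<close>

primrec word_ratio :: "('i \<Rightarrow> 'a \<Rightarrow> 'a) \<Rightarrow> ('i \<Rightarrow> 'a \<Rightarrow> real) \<Rightarrow> 'i list \<Rightarrow> 'a \<Rightarrow> real" where
  "word_ratio F \<rho> [] x = 1"
| "word_ratio F \<rho> (i # w) x = \<rho> i (word_map F w x) * word_ratio F \<rho> w x"

lemma word_map_append: "word_map F (v @ w) x = word_map F v (word_map F w x)"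
  by (induction v) auto

lemma word_ratio_append:
  "word_ratio F \<rho> (v @ w) x = word_ratio F \<rho> v (word_map F w x) * word_ratio F \<rho> w x"
  by (induction v) (auto simp: word_map_append)

text \<open>
  Finitely many maps \<open>F i\<close> with separated images, each of which shrinks the gauge \<open>d\<close> at \<open>x\<close>, \<open>y\<close> by at
  most the symmetric factor \<open>\<rho> i x * \<rho> i y\<close>. The maps may be far from conformal: \<open>\<rho>\<^sup>2\<close> is a lower bound
  that plays the role of their smaller singular value.
  The function \<open>h\<close> witnesses that the transfer operator with potential \<open>\<rho> powr p\<close> has spectral radius
  at least 1. The scale at which a piece is resolved is about \<open>\<rho>\<^sup>2\<close>, which is why \<open>p\<close> corresponds to
  dimension \<open>p / 2\<close>.
\<close>

locale weighted_ifs =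
  fixes K :: "'a::metric_space set" and I :: "'i set" and F :: "'i \<Rightarrow> 'a \<Rightarrow> 'a"
    and \<rho> :: "'i \<Rightarrow> 'a \<Rightarrow> real" and d :: "'a \<Rightarrow> 'a \<Rightarrow> real" and h :: "'a \<Rightarrow> real"
    and p q C \<delta> a b :: real
  assumes compact_K: "compact K" and K_ne: "K \<noteq> {}" and fin_I: "finite I"
    and maps: "i \<in> I \<Longrightarrow> x \<in> K \<Longrightarrow> F i x \<in> K"
    and ratio_pos: "i \<in> I \<Longrightarrow> x \<in> K \<Longrightarrow> 0 < \<rho> i x"
    and ratio_le: "i \<in> I \<Longrightarrow> x \<in> K \<Longrightarrow> \<rho> i x \<le> q" and q_less_1: "q < 1"
    and d_le_dist: "d x y \<le> dist x y"
    and expansion: "i \<in> I \<Longrightarrow> x \<in> K \<Longrightarrow> y \<in> K \<Longrightarrow> \<rho> i x * \<rho> i y * d x y \<le> d (F i x) (F i y)"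
    and delta_pos: "0 < \<delta>"
    and separated: "i \<in> I \<Longrightarrow> j \<in> I \<Longrightarrow> i \<noteq> j \<Longrightarrow> x \<in> K \<Longrightarrow> y \<in> K \<Longrightarrow> \<delta> \<le> d (F i x) (F j y)"
    and C_pos: "0 < C"
    and distortion: "set w \<subseteq> I \<Longrightarrow> x \<in> K \<Longrightarrow> y \<in> K \<Longrightarrow>
      word_ratio F \<rho> w x \<le> C * word_ratio F \<rho> w y"
    and p_pos: "0 < p" and a_pos: "0 < a"
    and h_bounds: "x \<in> K \<Longrightarrow> a \<le> h x" "x \<in> K \<Longrightarrow> h x \<le> b"
    and subinvariant: "x \<in> K \<Longrightarrow> h x \<le> (\<Sum>i\<in>I. \<rho> i x powr p * h (F i x))"
begin

abbreviation "g \<equiv> word_map F"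
abbreviation "r \<equiv> word_ratio F \<rho>"

lemma word_map_in: "set w \<subseteq> I \<Longrightarrow> x \<in> K \<Longrightarrow> g w x \<in> K"
  by (induction w) (auto intro: maps)

lemma word_ratio_pos: "set w \<subseteq> I \<Longrightarrow> x \<in> K \<Longrightarrow> 0 < r w x"
  by (induction w) (auto intro!: mult_pos_pos ratio_pos word_map_in)

lemma word_ratio_le: "set w \<subseteq> I \<Longrightarrow> x \<in> K \<Longrightarrow> r w x \<le> q ^ length w"
proof (induction w)
  case (Cons i w)
  have i: "i \<in> I" and g: "g w x \<in> K" using Cons.prems by (auto intro: word_map_in)
  have "0 < q" using ratio_pos[OF i g] ratio_le[OF i g] by linarith
  then show ?case
    using Cons ratio_pos[OF i g] ratio_le[OF i g] word_ratio_pos[of w x]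
    by (auto intro!: mult_mono)
qed auto

lemma word_expansion:
  "set w \<subseteq> I \<Longrightarrow> x \<in> K \<Longrightarrow> y \<in> K \<Longrightarrow> r w x * r w y * d x y \<le> d (g w x) (g w y)"
proof (induction w)
  case (Cons i w)
  have i: "i \<in> I" and gx: "g w x \<in> K" and gy: "g w y \<in> K"
    using Cons.prems by (auto intro: word_map_in)
  have "r (i # w) x * r (i # w) y * d x y = (\<rho> i (g w x) * \<rho> i (g w y)) * (r w x * r w y * d x y)"
    by simp
  also have "\<dots> \<le> (\<rho> i (g w x) * \<rho> i (g w y)) * d (g w x) (g w y)"
    using Cons ratio_pos[OF i gx] ratio_pos[OF i gy] by (intro mult_left_mono) auto
  also have "\<dots> \<le> d (F i (g w x)) (F i (g w y))" by (rule expansion[OF i gx gy])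
  finally show ?case by simp
qed auto

definition x0 :: 'a where "x0 = (SOME x. x \<in> K)"

lemma x0: "x0 \<in> K" using K_ne by (simp add: x0_def some_in_eq)

text \<open>
  The mass of the piece of \<open>w\<close> when the iterated transfer operator is truncated \<open>k\<close> levels below \<open>w\<close>.
  An eigenmeasure would give masses that are additive at all depths, but its existence requires a
  fixed point theorem. The truncated masses are additive down to their level by definition, and that
  is enough for finite covers.
\<close>

primrec weight :: "nat \<Rightarrow> 'i list \<Rightarrow> real" where
  "weight 0 w = r w x0 powr p * h (g w x0)"
| "weight (Suc k) w = (\<Sum>i\<in>I. weight k (w @ [i]))"

definition B :: real where "B = C powr p * (b / a)"

lemma h_pos: "x \<in> K \<Longrightarrow> 0 < h x" using h_bounds(1) a_pos by fastforce

lemma I_ne: "I \<noteq> {}"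
  using subinvariant[OF x0] h_pos[OF x0] by auto

lemma q_pos: "0 < q"
proof -
  obtain i where "i \<in> I" using I_ne by blast
  then show ?thesis using ratio_pos[OF _ x0, of i] ratio_le[OF _ x0, of i] by linarith
qed

lemma ab: "a \<le> b" using h_bounds[OF x0] by linarith

lemma B_pos: "0 < B" using ab a_pos C_pos by (simp add: B_def)

text \<open>
  Bounded distortion lets the factor of the prefix \<open>w\<close> be pulled out of the sum.
\<close>

lemma weight_prefix:
  assumes "set w \<subseteq> I"
  shows "set v \<subseteq> I \<Longrightarrow> weight k (w @ v) \<le> B * r w x0 powr p * weight k v"
proof (induction k arbitrary: v)
  case 0
  let ?y = "g v x0"
  have y: "?y \<in> K" and wy: "g w ?y \<in> K" using 0 assms x0 by (auto intro: word_map_in)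
  have "h (g w ?y) \<le> b * 1" using h_bounds(2)[OF wy] by simp
  also have "\<dots> \<le> b * (h ?y / a)"
    using h_bounds(1)[OF y] ab a_pos by (intro mult_left_mono) (auto simp: field_simps)
  finally have 1: "h (g w ?y) \<le> b / a * h ?y" by simp
  have "r w ?y powr p \<le> (C * r w x0) powr p"
    using word_ratio_pos[OF assms y] distortion[OF assms y x0] p_pos by (intro powr_mono2) auto
  also have "\<dots> = C powr p * r w x0 powr p"
    using C_pos word_ratio_pos[OF assms x0] by (simp add: powr_mult)
  finally have 2: "r w ?y powr p \<le> C powr p * r w x0 powr p" .
  have "weight 0 (w @ v) = r w ?y powr p * h (g w ?y) * r v x0 powr p"
    using word_ratio_pos[OF assms y] word_ratio_pos[OF 0 x0]
    by (simp add: word_ratio_append word_map_append powr_mult)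
  also have "\<dots> \<le> (C powr p * r w x0 powr p) * (b / a * h ?y) * r v x0 powr p"
    using 1 2 h_pos[OF wy] by (intro mult_right_mono mult_mono) auto
  finally show ?case by (simp add: B_def mult_ac)
next
  case (Suc k)
  have "weight (Suc k) (w @ v) = (\<Sum>i\<in>I. weight k (w @ (v @ [i])))" by simp
  also have "\<dots> \<le> (\<Sum>i\<in>I. B * r w x0 powr p * weight k (v @ [i]))"
    using Suc by (intro sum_mono Suc.IH) auto
  finally show ?case by (simp add: sum_distrib_left)
qed

text \<open>
  Subinvariance of \<open>h\<close> concerns the map applied last, that is, the leftmost letter. It therefore gives
  no inequality between a piece and its subpieces, but it does make the total mass at the root
  nondecreasing in the truncation level.
\<close>

lemma weight_outer: "set v \<subseteq> I \<Longrightarrow> weight k v \<le> (\<Sum>i\<in>I. weight k (i # v))"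
proof (induction k arbitrary: v)
  case 0
  let ?y = "g v x0"
  have y: "?y \<in> K" using 0 x0 by (auto intro: word_map_in)
  have "weight 0 v \<le> r v x0 powr p * (\<Sum>i\<in>I. \<rho> i ?y powr p * h (F i ?y))"
    using subinvariant[OF y] by (auto intro!: mult_left_mono)
  also have "\<dots> = (\<Sum>i\<in>I. weight 0 (i # v))"
    unfolding sum_distrib_left
    using ratio_pos[OF _ y] word_ratio_pos[OF 0 x0]
    by (intro sum.cong) (auto simp: powr_mult less_imp_le)
  finally show ?case .
next
  case (Suc k)
  have "weight (Suc k) v \<le> (\<Sum>j\<in>I. \<Sum>i\<in>I. weight k (i # (v @ [j])))"
    using Suc by (auto intro!: sum_mono Suc.IH)
  also have "\<dots> = (\<Sum>i\<in>I. \<Sum>j\<in>I. weight k (i # (v @ [j])))" by (rule sum.swap)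
  finally show ?case by simp
qed

lemma weight_mono: "k \<le> m \<Longrightarrow> weight k [] \<le> weight m []"
proof (induction m rule: dec_induct)
  case (step n)
  then show ?case using weight_outer[of "[]" n] by simp
qed simp

lemma weight_root_pos: "0 < weight k []"
proof -
  have "0 < weight 0 []" using h_pos[OF x0] by simp
  then show ?thesis using weight_mono[of 0 k] by linarith
qed

definition c0 :: real where "c0 = (\<delta> / C\<^sup>2) powr (p / 2) / B"

lemma c0_pos: "0 < c0" using delta_pos C_pos B_pos by (simp add: c0_def)

text \<open>
  Fix a truncation level \<open>M\<close> so deep that \<open>c0\<close> times the share of the total mass in a piece of level \<open>M\<close> is below
  every \<open>e j powr (p / 2)\<close>. Going from level \<open>M\<close> up to the root, the sets that hit a piece carry at least a fixed multiple of the
  share of mass of that piece. If some set hits two subpieces, separation and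
  expansion force its diameter to be at least a multiple of \<open>\<rho>\<^sup>2\<close>, and that single set pays for the whole
  piece. Otherwise the subpieces are hit by disjoint families of sets and their bounds add up.
\<close>

theorem finite_cover_bound:
  fixes U :: "'j \<Rightarrow> 'a set" and e :: "'j \<Rightarrow> real"
  assumes J: "finite J" and cover: "K \<subseteq> (\<Union>j\<in>J. U j)" and e_pos: "\<And>j. j \<in> J \<Longrightarrow> 0 < e j"
    and diam: "\<And>j x y. j \<in> J \<Longrightarrow> x \<in> U j \<Longrightarrow> y \<in> U j \<Longrightarrow> dist x y \<le> e j"
  shows "c0 \<le> (\<Sum>j\<in>J. e j powr (p / 2))"
proof -
  define hit where "hit w = {j \<in> J. U j \<inter> g w ` K \<noteq> {}}" for w
  have fin_hit: "finite (hit w)" for w using J by (simp add: hit_def)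
  have hit_ne: "hit w \<noteq> {}" if w: "set w \<subseteq> I" for w
  proof -
    obtain j where "j \<in> J" "g w x0 \<in> U j" using cover word_map_in[OF w x0] by blast
    then show ?thesis using x0 by (auto simp: hit_def)
  qed
  have single: "e j powr (p / 2) \<le> (\<Sum>j\<in>hit w. e j powr (p / 2))" if "j \<in> hit w" for j w
    using that fin_hit by (intro member_le_sum) auto
  \<comment> \<open>the smallest contribution of a set of the cover decides how deep the truncation has to be\<close>
  define m where "m = Min ((\<lambda>j. e j powr (p / 2)) ` J)"
  have J_ne: "J \<noteq> {}" using cover K_ne by auto
  have m_pos: "0 < m" unfolding m_def using J J_ne e_pos by (force simp: Min_gr_iff)
  have m_le: "m \<le> e j powr (p / 2)" if "j \<in> J" for j using that J by (simp add: m_def)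
  have "(\<lambda>n. c0 * B * (q powr p) ^ n) \<longlonglongrightarrow> c0 * B * 0"
    using q_pos q_less_1 p_pos powr_less_mono2[of p q 1]
    by (intro tendsto_intros LIMSEQ_power_zero) auto
  then have "\<forall>\<^sub>F n in sequentially. c0 * B * (q powr p) ^ n < m"
    using m_pos by (auto dest: order_tendstoD)
  then obtain M where M: "c0 * B * (q powr p) ^ M < m"
    by (auto dest!: eventually_happens)
  have weight_le: "weight k w \<le> B * r w x0 powr p * weight M []" if "set w \<subseteq> I" "k \<le> M" for k w
  proof -
    have "weight k (w @ []) \<le> B * r w x0 powr p * weight k []"
      by (rule weight_prefix[OF that(1)]) simp
    also have "\<dots> \<le> B * r w x0 powr p * weight M []"
      using weight_mono[OF that(2)] B_pos by (intro mult_left_mono) auto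
    finally show ?thesis by simp
  qed
  have main: "c0 * weight k w \<le> weight M [] * (\<Sum>j\<in>hit w. e j powr (p / 2))"
    if "set w \<subseteq> I" "length w + k = M" for k w
    using that
  proof (induction k arbitrary: w)
    case 0
    then obtain j where j: "j \<in> hit w" using hit_ne by blast
    have "r w x0 powr p \<le> (q ^ M) powr p"
      using word_ratio_le[OF 0(1) x0] word_ratio_pos[OF 0(1) x0] p_pos 0(2) by (intro powr_mono2) auto
    also have "\<dots> = (q powr p) ^ M"
      using q_pos by (simp add: powr_realpow[symmetric] powr_powr mult.commute)
    finally have "c0 * (B * r w x0 powr p * weight M []) \<le> c0 * (B * (q powr p) ^ M * weight M [])"
      using c0_pos B_pos weight_root_pos[of M] by (intro mult_left_mono mult_right_mono) auto
    also have "\<dots> = (c0 * B * (q powr p) ^ M) * weight M []" by simp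
    also have "\<dots> \<le> m * weight M []"
      using M weight_root_pos[of M] by (intro mult_right_mono) auto
    also have "m \<le> (\<Sum>j\<in>hit w. e j powr (p / 2))"
      using m_le[of j] single[OF j] j by (auto simp: hit_def)
    finally have "c0 * (B * r w x0 powr p * weight M []) \<le> (\<Sum>j\<in>hit w. e j powr (p / 2)) * weight M []"
      using weight_root_pos[of M] by simp
    moreover have "c0 * weight 0 w \<le> c0 * (B * r w x0 powr p * weight M [])"
      using weight_le[OF 0(1), of 0] c0_pos by (intro mult_left_mono) auto
    ultimately show ?case by (simp add: mult.commute)
  next
    case (Suc k)
    have hit_sub: "hit (w @ [i]) \<subseteq> hit w" if "i \<in> I" for i
      using that by (auto simp: hit_def word_map_append intro: maps)
    show ?case
    proof (cases "\<exists>i\<in>I. \<exists>i'\<in>I. i \<noteq> i' \<and> hit (w @ [i]) \<inter> hit (w @ [i']) \<noteq> {}")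
      case True
      then obtain i i' j where i: "i \<in> I" "i' \<in> I" "i \<noteq> i'"
        and j: "j \<in> hit (w @ [i])" "j \<in> hit (w @ [i'])" by blast
      obtain x y where xy: "x \<in> K" "y \<in> K" "g w (F i x) \<in> U j" "g w (F i' y) \<in> U j"
        using j by (auto simp: hit_def word_map_append)
      have Fx: "F i x \<in> K" "F i' y \<in> K" using i xy by (auto intro: maps)
      have jw: "j \<in> hit w" using j(1) hit_sub i by auto
      have lower: "r w x0 / C \<le> r w z" if "z \<in> K" for z
        using distortion[OF Suc.prems(1) x0 that] C_pos by (simp add: field_simps)
      have r0: "0 < r w x0" using word_ratio_pos[OF Suc.prems(1) x0] .
      have "(r w x0)\<^sup>2 * (\<delta> / C\<^sup>2) = (r w x0 / C) * (r w x0 / C) * \<delta>"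
        by (simp add: power2_eq_square)
      also have "\<dots> \<le> r w (F i x) * r w (F i' y) * d (F i x) (F i' y)"
      proof (intro mult_mono)
        show "r w x0 / C \<le> r w (F i x)" "r w x0 / C \<le> r w (F i' y)" by (intro lower Fx)+
        show "\<delta> \<le> d (F i x) (F i' y)" by (rule separated[OF i xy(1,2)])
        show "0 \<le> r w (F i x)" "0 \<le> r w (F i x) * r w (F i' y)"
          using word_ratio_pos[OF Suc.prems(1) Fx(1)] word_ratio_pos[OF Suc.prems(1) Fx(2)]
          by (simp_all add: less_imp_le)
        show "0 \<le> r w x0 / C" using r0 C_pos by simp
        show "0 \<le> \<delta>" using delta_pos by simp
      qed
      also have "\<dots> \<le> d (g w (F i x)) (g w (F i' y))"
        by (rule word_expansion[OF Suc.prems(1) Fx])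
      also have "\<dots> \<le> dist (g w (F i x)) (g w (F i' y))" by (rule d_le_dist)
      also have "\<dots> \<le> e j" using diam xy jw by (auto simp: hit_def)
      finally have "((r w x0)\<^sup>2 * (\<delta> / C\<^sup>2)) powr (p / 2) \<le> e j powr (p / 2)"
        using p_pos delta_pos C_pos by (intro powr_mono2) auto
      also have "((r w x0)\<^sup>2 * (\<delta> / C\<^sup>2)) powr (p / 2) = r w x0 powr p * (\<delta> / C\<^sup>2) powr (p / 2)"
      proof -
        have "(r w x0)\<^sup>2 powr (p / 2) = r w x0 powr p"
          using r0 powr_powr[of "r w x0" 2 "p / 2"] by simp
        then show ?thesis using delta_pos by (subst powr_mult) simp_all
      qed
      also have "\<dots> = c0 * (B * r w x0 powr p)" using B_pos by (simp add: c0_def)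
      finally have ej: "c0 * (B * r w x0 powr p) \<le> e j powr (p / 2)" .
      have "c0 * weight (Suc k) w \<le> c0 * (B * r w x0 powr p * weight M [])"
        using weight_le[of w "Suc k"] Suc.prems c0_pos by (intro mult_left_mono) auto
      also have "\<dots> = weight M [] * (c0 * (B * r w x0 powr p))"
        by (simp only: mult_ac)
      also have "\<dots> \<le> weight M [] * (\<Sum>j\<in>hit w. e j powr (p / 2))"
        using weight_root_pos[of M] by (intro mult_left_mono order_trans[OF ej single[OF jw]]) simp
      finally show ?thesis .
    next
      case False
      have "c0 * weight (Suc k) w = (\<Sum>i\<in>I. c0 * weight k (w @ [i]))"
        by (simp add: sum_distrib_left)
      also have "\<dots> \<le> (\<Sum>i\<in>I. weight M [] * (\<Sum>j\<in>hit (w @ [i]). e j powr (p / 2)))"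
        using Suc.prems by (intro sum_mono Suc.IH) auto
      also have "\<dots> = weight M [] * (\<Sum>i\<in>I. \<Sum>j\<in>hit (w @ [i]). e j powr (p / 2))"
        by (simp add: sum_distrib_left)
      also have "(\<Sum>i\<in>I. \<Sum>j\<in>hit (w @ [i]). e j powr (p / 2))
          = (\<Sum>j\<in>(\<Union>i\<in>I. hit (w @ [i])). e j powr (p / 2))"
        using False by (intro sum.UNION_disjoint[symmetric] fin_I ballI fin_hit) auto
      also have "weight M [] * \<dots> \<le> weight M [] * (\<Sum>j\<in>hit w. e j powr (p / 2))"
        using weight_root_pos[of M] hit_sub
        by (intro mult_left_mono sum_mono2 fin_hit) auto
      finally show ?thesis .
    qed
  qed
  have "c0 * weight M [] \<le> weight M [] * (\<Sum>j\<in>hit []. e j powr (p / 2))"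
    by (rule main) auto
  then have "c0 \<le> (\<Sum>j\<in>hit []. e j powr (p / 2))"
    using weight_root_pos[of M] by (simp add: mult.commute)
  also have "\<dots> \<le> (\<Sum>j\<in>J. e j powr (p / 2))"
    using J by (intro sum_mono2) (auto simp: hit_def)
  finally show ?thesis .
qed

end

section \<open>Hausdorff dimension from finite covers\<close>

lemma diam_pow_pos: "0 < s \<Longrightarrow> diam_pow s U = ennreal (diameter U powr s)"
  by (auto simp: diam_pow_def)

text \<open>
  Countable covers reduce to finite ones by compactness, after each set has been enlarged to an open
  one at a cost of at most \<open>c / 2\<close> in total. Below exponent \<open>s\<close> the sums only grow, since the diameters
  may be taken to be at most 1.
\<close>

lemma hausdorff_dim_ge_of_finite_cover_bound:
  fixes K :: "'a::metric_space set"
  assumes K: "compact K" and s: "0 < s" and c: "0 < c"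
    and bound: "\<And>(U :: nat \<Rightarrow> 'a set) e J. finite J \<Longrightarrow> K \<subseteq> (\<Union>j\<in>J. U j) \<Longrightarrow>
      (\<And>j. j \<in> J \<Longrightarrow> 0 < e j) \<Longrightarrow>
      (\<And>j x y. j \<in> J \<Longrightarrow> x \<in> U j \<Longrightarrow> y \<in> U j \<Longrightarrow> dist x y \<le> e j) \<Longrightarrow>
      c \<le> (\<Sum>j\<in>J. e j powr s)"
  shows "ereal s \<le> hausdorff_dim K"
proof -
  have countable_bound: "ennreal (c / 2) \<le> (\<Sum>i. diam_pow s (U i))"
    if cov: "K \<subseteq> (\<Union>i. U i)" and bdd: "\<And>i. bounded (U i)" for U :: "nat \<Rightarrow> 'a set"
  proof -
    define \<eta> where "\<eta> i = c / 2 * (1/2) ^ Suc i" for i :: nat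
    have \<eta>: "0 < \<eta> i" for i using c by (simp add: \<eta>_def)
    have "\<exists>\<epsilon>>0. (diameter (U i) + 2 * \<epsilon>) powr s \<le> diameter (U i) powr s + \<eta> i" for i
    proof -
      let ?f = "\<lambda>t. (diameter (U i) + 2 * t) powr s"
      have "((\<lambda>t. (diameter (U i) + 2 * t) powr s) \<longlongrightarrow> (diameter (U i) + 2 * 0) powr s) (at_right 0)"
        using s diameter_ge_0[OF bdd]
        by (intro tendsto_powr2 tendsto_intros) (auto simp: eventually_at_right_less
            intro!: eventually_at_rightI[of 0 1])
      then have "\<forall>\<^sub>F t in at_right 0. ?f t < diameter (U i) powr s + \<eta> i"
        by (rule order_tendstoD) (use \<eta> in simp)
      then have "\<forall>\<^sub>F t in at_right 0. ?f t < diameter (U i) powr s + \<eta> i \<and> 0 < t"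
        using eventually_at_right_less[of 0] by eventually_elim auto
      then obtain t where "?f t < diameter (U i) powr s + \<eta> i" "0 < t"
        by (auto dest!: eventually_happens'[rotated])
      then show ?thesis by (intro exI[of _ t]) auto
    qed
    then obtain \<epsilon> where \<epsilon>: "\<And>i. 0 < \<epsilon> i"
      "\<And>i. (diameter (U i) + 2 * \<epsilon> i) powr s \<le> diameter (U i) powr s + \<eta> i" by metis
    define V where "V i = (\<Union>x\<in>U i. ball x (\<epsilon> i))" for i
    have KV: "K \<subseteq> (\<Union>i. V i)" using cov \<epsilon>(1) by (force simp: V_def)
    have open_V: "open (V i)" for i by (auto simp: V_def)
    obtain J where J: "finite J" "K \<subseteq> (\<Union>i\<in>J. V i)"
      using compactE_image[OF K open_V KV] by metis
    have "c \<le> (\<Sum>j\<in>J. (diameter (U j) + 2 * \<epsilon> j) powr s)"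
    proof (rule bound[OF J])
      fix j show "0 < diameter (U j) + 2 * \<epsilon> j"
        using \<epsilon>(1)[of j] diameter_ge_0[OF bdd, of j] by simp
      fix x y assume "x \<in> V j" "y \<in> V j"
      then obtain x' y' where x': "x' \<in> U j" "dist x' x < \<epsilon> j" and y': "y' \<in> U j" "dist y' y < \<epsilon> j"
        by (auto simp: V_def)
      have "dist x y \<le> dist x' x + dist x' y' + dist y' y"
        by (metis dist_commute dist_triangle_le add.assoc dist_triangle add_mono order_refl)
      then show "dist x y \<le> diameter (U j) + 2 * \<epsilon> j"
        using x' y' diameter_bounded_bound[OF bdd x'(1) y'(1)] by linarith
    qed
    also have "\<dots> \<le> (\<Sum>j\<in>J. diameter (U j) powr s + \<eta> j)" by (intro sum_mono \<epsilon>(2))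
    also have "\<dots> = (\<Sum>j\<in>J. diameter (U j) powr s) + (\<Sum>j\<in>J. \<eta> j)" by (rule sum.distrib)
    also have "(\<Sum>j\<in>J. \<eta> j) \<le> c / 2"
    proof -
      have "\<eta> sums (c / 2 * 1)" unfolding \<eta>_def by (intro sums_mult power_half_series)
      then show ?thesis
        using J(1) \<eta> sum_le_suminf[of \<eta> J] by (auto simp: sums_iff less_imp_le)
    qed
    finally have "c / 2 \<le> (\<Sum>j\<in>J. diameter (U j) powr s)" by simp
    then have "ennreal (c / 2) \<le> ennreal (\<Sum>j\<in>J. diameter (U j) powr s)"
      by (rule ennreal_leI)
    also have "\<dots> = (\<Sum>j\<in>J. diam_pow s (U j))"
      using s by (subst sum_ennreal[symmetric]) (auto intro!: sum.cong simp: diam_pow_pos)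
    also have "\<dots> \<le> (\<Sum>i. diam_pow s (U i))" using J(1) by (intro sum_le_suminf) auto
    finally show ?thesis .
  qed
  have "s \<le> t" if t: "0 \<le> t" and zero: "hausdorff_measure t K = 0" for t
  proof (rule ccontr)
    assume "\<not> s \<le> t"
    have "hausdorff_premeasure t 1 K \<le> hausdorff_measure t K"
      unfolding hausdorff_measure_def by (intro SUP_upper) auto
    then have "hausdorff_premeasure t 1 K < ennreal (c / 2)" using zero c by simp
    then obtain U :: "nat \<Rightarrow> 'a set" where U: "K \<subseteq> (\<Union>i. U i)" "\<And>i. bounded (U i)"
      "\<And>i. diameter (U i) \<le> 1" and small: "(\<Sum>i. diam_pow t (U i)) < ennreal (c / 2)"
      unfolding hausdorff_premeasure_def INF_less_iff by blast
    have "diam_pow s (U i) \<le> diam_pow t (U i)" for i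
    proof (cases "t = 0 \<or> diameter (U i) = 0")
      case True
      then show ?thesis using s U(2)[of i] U(3)[of i] diameter_ge_0[OF U(2), of i]
        by (auto simp: diam_pow_def intro!: powr_le1)
    next
      case False
      then show ?thesis
        using s U(3)[of i] diameter_ge_0[OF U(2), of i] \<open>\<not> s \<le> t\<close> t
        by (auto simp: diam_pow_def intro!: ennreal_leI powr_mono')
    qed
    then have "(\<Sum>i. diam_pow s (U i)) \<le> (\<Sum>i. diam_pow t (U i))"
      by (intro suminf_le) auto
    with countable_bound[OF U(1,2)] small show False by simp
  qed
  then show ?thesis unfolding hausdorff_dim_def by (auto intro!: Inf_greatest)
qed

lemma hausdorff_dim_mono:
  assumes "A \<subseteq> B" shows "hausdorff_dim A \<le> hausdorff_dim B"
proof -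
  have "hausdorff_premeasure t \<epsilon> A \<le> hausdorff_premeasure t \<epsilon> B" for t \<epsilon>
    unfolding hausdorff_premeasure_def using assms by (intro INF_superset_mono) auto
  then have "hausdorff_measure t A \<le> hausdorff_measure t B" for t
    unfolding hausdorff_measure_def by (intro SUP_mono) auto
  then have "hausdorff_measure t A = 0" if "hausdorff_measure t B = 0" for t
    using that by (metis le_zero_eq)
  then show ?thesis unfolding hausdorff_dim_def by (intro Inf_superset_mono) auto
qed

section \<open>The accelerated branches on the gasket\<close>

definition relabel :: "(3 \<Rightarrow> 3) \<Rightarrow> real^3 \<Rightarrow> real^3" where
  "relabel \<sigma> x = (\<chi> i. x $ \<sigma> i)"

lemma relabel_nth [simp]: "relabel \<sigma> x $ i = x $ \<sigma> i"
  by (simp add: relabel_def)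

lemma relabel_diff: "relabel \<sigma> x - relabel \<sigma> y = relabel \<sigma> (x - y)"
  by (simp add: vec_eq_iff)

lemma relabel_in_simplex:
  assumes "bij \<sigma>" "x \<in> std_simplex" shows "relabel \<sigma> x \<in> std_simplex"
  using assms sum.reindex_bij_betw[of \<sigma> UNIV UNIV "\<lambda>i. x $ i"] by (auto simp: std_simplex_def)

lemma infnorm_relabel:
  assumes "bij \<sigma>" shows "infnorm (relabel \<sigma> x) = infnorm x"
proof -
  have "{\<bar>x $ \<sigma> i\<bar> |i. i \<in> UNIV} = (\<lambda>k. \<bar>x $ k\<bar>) ` range \<sigma>" by auto
  also have "\<dots> = {\<bar>x $ i\<bar> |i. i \<in> UNIV}" using bij_is_surj[OF assms] by auto
  finally show ?thesis by (simp add: infnorm_cart)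
qed

lemma continuous_on_relabel: "continuous_on S (relabel \<sigma>)"
  unfolding relabel_def by (intro continuous_on_vec_lambda continuous_intros)

lemma rauzy_map_relabel:
  assumes "bij \<sigma>" "x \<in> std_simplex"
  shows "rauzy_map j (relabel \<sigma> x) = relabel \<sigma> (rauzy_map (\<sigma> j) x)"
  using assms bij_is_inj[OF assms(1)]
  by (simp add: vec_eq_iff rauzy_map_nth relabel_in_simplex inj_eq)

lemma gasket_simplex: "rauzy_gasket \<subseteq> std_simplex"
  and gasket_compact: "compact rauzy_gasket"
  and gasket_nonempty: "rauzy_gasket \<noteq> {}"
  and gasket_eq: "rauzy_gasket = (\<Union>j. rauzy_map j ` rauzy_gasket)"
  using is_rauzy_gasket_rauzy_gasket by (auto simp: is_rauzy_gasket_def UNIV_3)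

lemma gasket_rauzy_map: "x \<in> rauzy_gasket \<Longrightarrow> rauzy_map j x \<in> rauzy_gasket"
  using gasket_eq by blast

text \<open>
  The image of the gasket under a permutation of coordinates satisfies the same fixed point equation, so
  uniqueness identifies the two.
\<close>

lemma gasket_relabel:
  assumes \<sigma>: "bij \<sigma>" and x: "x \<in> rauzy_gasket"
  shows "relabel \<sigma> x \<in> rauzy_gasket"
proof -
  let ?R = "relabel \<sigma> ` rauzy_gasket"
  have "(\<Union>j. rauzy_map j ` ?R) = (\<Union>j. relabel \<sigma> ` rauzy_map (\<sigma> j) ` rauzy_gasket)"
    using gasket_simplex by (auto simp: image_image rauzy_map_relabel[OF \<sigma>] subset_iff)
  also have "\<dots> = (\<Union>k\<in>range \<sigma>. relabel \<sigma> ` rauzy_map k ` rauzy_gasket)" by blast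
  also have "\<dots> = relabel \<sigma> ` (\<Union>k. rauzy_map k ` rauzy_gasket)"
    using bij_is_surj[OF \<sigma>] by blast
  also have "\<dots> = ?R" by (simp only: gasket_eq[symmetric])
  finally have inv: "?R = rauzy_map 1 ` ?R \<union> rauzy_map 2 ` ?R \<union> rauzy_map 3 ` ?R"
    by (simp add: UNIV_3 Un_assoc)
  have "compact ?R" "?R \<noteq> {}" "?R \<subseteq> std_simplex"
    using gasket_simplex gasket_nonempty gasket_compact relabel_in_simplex[OF \<sigma>]
    by (auto intro!: compact_continuous_image continuous_on_relabel)
  with inv have "is_rauzy_gasket ?R" unfolding is_rauzy_gasket_def by blast
  then show ?thesis
    using rauzy_gasket_unique[OF _ is_rauzy_gasket_rauzy_gasket] x by blast
qed

text \<open>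
  The 1-norm of the unnormalized image of \<open>x\<close> under the \<open>n\<close>-th power of the first matrix.
\<close>

definition len :: "nat \<Rightarrow> real^3 \<Rightarrow> real" where
  "len n x = 1 + real n * (1 - x $ 1)"

definition run :: "nat \<Rightarrow> real^3 \<Rightarrow> real^3" where
  "run n x = (rauzy_map 1 ^^ n) x"

text \<open>
  A maximal run of the first map, followed by exchanging coordinate 1 with coordinate 2 or 3. Up to the
  symmetry of the gasket this is a run of one letter followed by a change of letter, so the exchange
  turns three alternating families of runs into one iterated function system on a single set.
\<close>

definition branch :: "nat \<times> 3 \<Rightarrow> real^3 \<Rightarrow> real^3" where
  "branch i x = relabel (Transposition.transpose 1 (snd i)) (run (fst i) x)"

text \<open>
  One of the last two coordinates is at least \<open>1/2\<close>, which puts the core into the second and third cell. The vertices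
  \<open>e\<^sub>2\<close> and \<open>e\<^sub>3\<close> are cut off because the closed cells of the gasket touch exactly at images of vertices;
  without them the images of the branches are disjoint. Runs of length at most 40 stay at distance \<open>1/42\<close>
  from these vertices.
\<close>

definition core :: "(real^3) set" where
  "core = {x \<in> rauzy_gasket. (1/2 \<le> x $ 2 \<or> 1/2 \<le> x $ 3) \<and> x $ 2 \<le> 41/42 \<and> x $ 3 \<le> 41/42}"

definition branches :: "(nat \<times> 3) set" where
  "branches = {1..40} \<times> {2, 3}"

lemma simplexD:
  assumes "x \<in> std_simplex"
  shows "0 \<le> x $ i" "x $ i \<le> 1" "x $ 1 + x $ 2 + x $ 3 = 1"
  using assms std_simplex_le_1[OF assms] by (auto simp: std_simplex_def sum_3)

lemma coreD: "x \<in> core \<Longrightarrow> x \<in> std_simplex" "x \<in> core \<Longrightarrow> x $ 1 \<le> 1/2"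
proof -
  assume x: "x \<in> core"
  then show 1: "x \<in> std_simplex" using gasket_simplex by (auto simp: core_def)
  have "1/2 \<le> x $ 2 \<or> 1/2 \<le> x $ 3" using x by (simp add: core_def)
  then show "x $ 1 \<le> 1/2"
    using simplexD(3)[OF 1] simplexD(1)[OF 1, of 2] simplexD(1)[OF 1, of 3] by linarith
qed

lemma len_ge_1: "x \<in> std_simplex \<Longrightarrow> 1 \<le> len n x"
  using simplexD(2)[of x 1] by (simp add: len_def)

lemma run_in_simplex: "x \<in> std_simplex \<Longrightarrow> run n x \<in> std_simplex"
  unfolding run_def by (induction n) (auto intro: rauzy_map_in_simplex)

lemma run_nth:
  assumes "x \<in> std_simplex"
  shows "run n x $ i = (if i = 1 then x $ 1 + real n * (1 - x $ 1) else x $ i) / len n x"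
proof (induction n arbitrary: i)
  case (Suc n)
  have l: "0 < len n x" "0 < len (Suc n) x" using len_ge_1[OF assms] by (auto intro: less_le_trans[OF zero_less_one])
  have two: "2 - run n x $ 1 = len (Suc n) x / len n x"
    using l by (simp add: Suc.IH field_simps) (simp add: len_def algebra_simps)
  have one: "len n x = x $ 1 + real (Suc n) * (1 - x $ 1)"
    by (simp add: len_def algebra_simps)
  have "run (Suc n) x $ i = (if i = 1 then 1 else run n x $ i) / (2 - run n x $ 1)"
    using rauzy_map_nth[OF run_in_simplex[OF assms]] by (simp add: run_def)
  then show ?case unfolding two using l one by (auto simp: Suc.IH)
qed (simp add: run_def len_def)

lemma bij_transpose_1: "bij (Transposition.transpose (1::3) j)" by simp

lemma branch_in_simplex: "x \<in> std_simplex \<Longrightarrow> branch i x \<in> std_simplex"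
  unfolding branch_def by (intro relabel_in_simplex bij_transpose_1 run_in_simplex)

lemma branch_nth:
  assumes x: "x \<in> std_simplex"
  shows "branch (n, 2) x $ 1 = x $ 2 / len n x"
    "branch (n, 2) x $ 2 = (x $ 1 + real n * (1 - x $ 1)) / len n x"
    "branch (n, 2) x $ 3 = x $ 3 / len n x"
    "branch (n, 3) x $ 1 = x $ 3 / len n x"
    "branch (n, 3) x $ 2 = x $ 2 / len n x"
    "branch (n, 3) x $ 3 = (x $ 1 + real n * (1 - x $ 1)) / len n x"
  by (simp_all add: branch_def run_nth[OF x] Transposition.transpose_def)

text \<open>
  The projective map divides \<open>(b, c)\<close> by \<open>1 + n * (b + c)\<close>; the first entry of each maximum is the difference of
  the remaining barycentric coordinate. After multiplication by \<open>l * l'\<close> the differences of \<open>b\<close> and of \<open>c\<close> change by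
  \<open>n * w\<close> and \<open>- n * w\<close>, and the third one does not change. If \<open>b - b'\<close> and \<open>c - c'\<close> have the same sign, the third
  one is the largest. If not, \<open>w\<close> has the sign of \<open>b - b'\<close>, so neither of them decreases in absolute value.
\<close>

lemma projective_expansion:
  fixes b c b' c' n :: real
  assumes nn: "0 \<le> b" "0 \<le> c" "0 \<le> b'" "0 \<le> c'" "0 \<le> n"
  defines "l \<equiv> 1 + n * (b + c)" and "l' \<equiv> 1 + n * (b' + c')"
    and "m \<equiv> Max {\<bar>(b + c) - (b' + c')\<bar>, \<bar>b - b'\<bar>, \<bar>c - c'\<bar>}"
  shows "m / (l * l') \<le> Max {\<bar>(b + c) / l - (b' + c') / l'\<bar>, \<bar>b / l - b' / l'\<bar>, \<bar>c / l - c' / l'\<bar>}"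
proof -
  have l: "0 < l" "0 < l'" using nn by (auto simp: l_def l'_def add_pos_nonneg)
  define w where "w = b * c' - b' * c"
  have eqs: "(b + c) / l - (b' + c') / l' = ((b + c) - (b' + c')) / (l * l')"
    "b / l - b' / l' = ((b - b') + n * w) / (l * l')"
    "c / l - c' / l' = ((c - c') - n * w) / (l * l')"
    using l by (simp_all add: field_simps) (simp_all add: l_def l'_def w_def algebra_simps)
  have abs_eq: "\<bar>x / (l * l')\<bar> = \<bar>x\<bar> / (l * l')" for x using l by (simp add: abs_mult)
  have w: "w = c * (b - b') - b * (c - c')" by (simp add: w_def algebra_simps)
  consider "0 \<le> (b - b') * (c - c')" | "b - b' > 0" "c - c' < 0" | "b - b' < 0" "c - c' > 0"
    by (metis linorder_not_le mult_nonneg_nonneg mult_nonpos_nonpos order_le_less not_less_iff_gr_or_eq)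
  then have "m \<le> Max {\<bar>(b + c) - (b' + c')\<bar>, \<bar>(b - b') + n * w\<bar>, \<bar>(c - c') - n * w\<bar>}"
  proof cases
    case 1
    then have "m = \<bar>(b + c) - (b' + c')\<bar>" by (auto simp: m_def zero_le_mult_iff)
    then show ?thesis by simp
  next
    case 2
    then have "0 \<le> w" unfolding w using nn by (smt (verit) mult_nonneg_nonneg mult_nonneg_nonpos)
    then have "0 \<le> n * w" using nn by simp
    then show ?thesis using 2 by (auto simp: m_def)
  next
    case 3
    then have "w \<le> 0" unfolding w using nn by (smt (verit) mult_nonneg_nonneg mult_nonneg_nonpos)
    then have "n * w \<le> 0" using nn by (simp add: mult_nonneg_nonpos)
    then show ?thesis using 3 by (auto simp: m_def)
  qed
  then have "m / (l * l') \<le> Max {\<bar>(b + c) - (b' + c')\<bar>, \<bar>(b - b') + n * w\<bar>, \<bar>(c - c') - n * w\<bar>} / (l * l')"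
    using l by (intro divide_right_mono) auto
  also have "\<dots> \<le> Max {\<bar>(b + c) / l - (b' + c') / l'\<bar>, \<bar>b / l - b' / l'\<bar>, \<bar>c / l - c' / l'\<bar>}"
    unfolding eqs abs_eq by (auto simp: max_def)
  finally show ?thesis .
qed

lemma branch_expansion:
  assumes x: "x \<in> std_simplex" and y: "y \<in> std_simplex"
  shows "1 / len (fst i) x * (1 / len (fst i) y) * infnorm (x - y) \<le> infnorm (branch i x - branch i y)"
proof -
  define n where "n = fst i"
  have sx: "1 - x $ 1 = x $ 2 + x $ 3" and sy: "1 - y $ 1 = y $ 2 + y $ 3"
    using simplexD(3)[OF x] simplexD(3)[OF y] by auto
  have l: "0 < len n x" "0 < len n y" using len_ge_1[OF x] len_ge_1[OF y]
    by (auto intro: less_le_trans[OF zero_less_one])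
  have lx: "len n x = 1 + real n * (x $ 2 + x $ 3)" and ly: "len n y = 1 + real n * (y $ 2 + y $ 3)"
    by (simp_all add: len_def sx sy)
  have first: "run n z $ 1 = 1 - (z $ 2 + z $ 3) / len n z" if "z \<in> std_simplex" "0 < len n z" for z
  proof -
    have "z $ 1 + real n * (1 - z $ 1) = len n z - (z $ 2 + z $ 3)"
      using simplexD(3)[OF that(1)] by (simp add: len_def)
    then show ?thesis using that by (simp add: run_nth diff_divide_distrib)
  qed
  have "1 / len n x * (1 / len n y) * infnorm (x - y)
    = Max {\<bar>(x $ 2 + x $ 3) - (y $ 2 + y $ 3)\<bar>, \<bar>x $ 2 - y $ 2\<bar>, \<bar>x $ 3 - y $ 3\<bar>} / (len n x * len n y)"
    using sx sy by (simp add: infnorm_3 abs_minus_commute flip: sx sy)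
  also have "\<dots> \<le> Max {\<bar>(x $ 2 + x $ 3) / len n x - (y $ 2 + y $ 3) / len n y\<bar>,
      \<bar>x $ 2 / len n x - y $ 2 / len n y\<bar>, \<bar>x $ 3 / len n x - y $ 3 / len n y\<bar>}"
    unfolding lx ly
    using simplexD(1)[OF x] simplexD(1)[OF y] by (intro projective_expansion) auto
  also have "\<dots> = infnorm (run n x - run n y)"
    unfolding infnorm_3 using first[OF x l(1)] first[OF y l(2)]
    by (simp add: run_nth x y abs_minus_commute)
  also have "\<dots> = infnorm (branch i x - branch i y)"
    by (simp add: branch_def relabel_diff infnorm_relabel n_def)
  finally show ?thesis by (simp add: n_def)
qed

lemma branchesE:
  assumes "i \<in> branches"
  obtains n where "i = (n, 2) \<or> i = (n, 3)" "1 \<le> n" "n \<le> 40"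
  using assms by (auto simp: branches_def)

lemma gasket_branch:
  assumes "x \<in> rauzy_gasket" shows "branch i x \<in> rauzy_gasket"
proof -
  have "run n x \<in> rauzy_gasket" for n
    unfolding run_def using assms by (induction n) (auto intro: gasket_rauzy_map)
  then show ?thesis unfolding branch_def by (intro gasket_relabel bij_transpose_1)
qed

lemma run_first_bounds:
  assumes x: "x \<in> core" and n: "1 \<le> n" "n \<le> 40"
  shows "1/2 \<le> (x $ 1 + real n * (1 - x $ 1)) / len n x"
    "(x $ 1 + real n * (1 - x $ 1)) / len n x \<le> 41/42"
proof -
  note s = coreD(1)[OF x]
  have l: "0 < len n x" using len_ge_1[OF s, of n] by linarith
  have u: "1/2 \<le> 1 - x $ 1" "0 \<le> x $ 1" using coreD(2)[OF x] simplexD(1)[OF s] by auto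
  have "1 * (1 - x $ 1) \<le> real n * (1 - x $ 1)" using n u by (intro mult_right_mono) auto
  then show "1/2 \<le> (x $ 1 + real n * (1 - x $ 1)) / len n x"
    using l u by (simp add: field_simps len_def)
  have "real n * (1 - x $ 1) \<le> 40 * (1 - x $ 1)" using n u by (intro mult_right_mono) auto
  then show "(x $ 1 + real n * (1 - x $ 1)) / len n x \<le> 41/42"
    using l u by (simp add: field_simps len_def)
qed

lemma branch_core:
  assumes i: "i \<in> branches" and x: "x \<in> core" shows "branch i x \<in> core"
proof -
  from i obtain n where n: "i = (n, 2) \<or> i = (n, 3)" "1 \<le> n" "n \<le> 40" by (rule branchesE)
  note s = branch_in_simplex[OF coreD(1)[OF x], of i]
  have g: "branch i x \<in> rauzy_gasket" using x by (auto simp: core_def intro: gasket_branch)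
  have "1/2 \<le> branch i x $ 2 \<and> branch i x $ 2 \<le> 41/42 \<or> 1/2 \<le> branch i x $ 3 \<and> branch i x $ 3 \<le> 41/42"
    using n(1) run_first_bounds[OF x n(2,3)] branch_nth(2,6)[OF coreD(1)[OF x], of n] by auto
  then show ?thesis
    using g simplexD(3)[OF s] simplexD(1)[OF s, of 1] simplexD(1)[OF s, of 2] simplexD(1)[OF s, of 3]
    unfolding core_def by (simp, linarith)
qed

lemma core_compact: "compact core"
proof -
  have "core = rauzy_gasket \<inter> (({x. 1/2 \<le> x $ 2} \<union> {x. 1/2 \<le> x $ 3}) \<inter> {x. x $ 2 \<le> 41/42} \<inter> {x. x $ 3 \<le> 41/42})"
    by (auto simp: core_def)
  also have "compact \<dots>"
    by (intro compact_Int_closed[OF gasket_compact] closed_Int closed_Un closed_Collect_le continuous_intros)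
  finally show ?thesis .
qed

lemma core_nonempty: "core \<noteq> {}"
proof -
  obtain x where x: "x \<in> rauzy_gasket" using gasket_nonempty by blast
  define y where "y = rauzy_map 3 x"
  have y: "y \<in> rauzy_gasket" unfolding y_def by (rule gasket_rauzy_map[OF x])
  note sx = subsetD[OF gasket_simplex x] and sy = subsetD[OF gasket_simplex y]
  note sz = rauzy_map_in_simplex[OF sy, of 2]
  have "1/2 \<le> y $ 3"
    using simplexD(1,2)[OF sx, of 3] by (simp add: y_def rauzy_map_nth[OF sx] field_simps)
  then have "y $ 2 \<le> 1/2" "0 \<le> y $ 2"
    using simplexD(3)[OF sy] simplexD(1)[OF sy, of 1] simplexD(1)[OF sy, of 2] by auto
  then have "1/2 \<le> rauzy_map 2 y $ 2" "rauzy_map 2 y $ 2 \<le> 41/42"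
    by (simp_all add: rauzy_map_nth[OF sy] field_simps)
  then have "rauzy_map 2 y \<in> core"
    using gasket_rauzy_map[OF y, of 2] simplexD(3)[OF sz] simplexD(1)[OF sz, of 1]
    by (auto simp: core_def)
  then show ?thesis by blast
qed

text \<open>
  Let \<open>u = 1 - x $ 1\<close> and \<open>v = 1 - y $ 1\<close>. Comparing the sums of the last two coordinates of \<open>run n x = run m y\<close> gives
  \<open>1 / u + n = 1 / v + m\<close> with both reciprocals in \<open>[1, 2]\<close>. Hence the runs differ by one step, \<open>u = 1/2\<close> and \<open>v = 1\<close>, and \<open>y\<close> is twice \<open>x\<close> in its last two
  coordinates, which makes \<open>y\<close> a vertex.
\<close>

lemma run_disjoint:
  assumes x: "x \<in> core" and y: "y \<in> core" and nm: "n < m" and eq: "run n x = run m y"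
  shows False
proof -
  note sx = coreD(1)[OF x] and sy = coreD(1)[OF y]
  have l: "0 < len n x" "0 < len m y" using len_ge_1[OF sx, of n] len_ge_1[OF sy, of m] by linarith+
  define u v where "u = 1 - x $ 1" and "v = 1 - y $ 1"
  have uv: "1/2 \<le> u" "v \<le> 1" "0 < u" "0 < v"
    using coreD(2)[OF x] coreD(2)[OF y] simplexD(1)[OF sy, of 1] by (auto simp: u_def v_def)
  have c: "x $ 2 * len m y = y $ 2 * len n x" "x $ 3 * len m y = y $ 3 * len n x"
    using arg_cong[OF eq, of "\<lambda>z. z $ 2"] arg_cong[OF eq, of "\<lambda>z. z $ 3"] l
    by (simp_all add: run_nth sx sy field_simps)
  have "u * len m y = v * len n x"
  proof -
    have "u = x $ 2 + x $ 3" "v = y $ 2 + y $ 3"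
      using simplexD(3)[OF sx] simplexD(3)[OF sy] by (auto simp: u_def v_def)
    then show ?thesis using c by (simp add: distrib_right)
  qed
  then have uv_eq: "v = u + (real m - real n) * (u * v)"
    by (simp add: len_def u_def[symmetric] v_def[symmetric] algebra_simps)
  have "1 * (u * v) \<le> (real m - real n) * (u * v)" using nm uv by (intro mult_right_mono) auto
  then have "u + u * v \<le> v" using uv_eq by simp
  moreover have "1/2 * v \<le> u * v" using uv by (intro mult_right_mono) auto
  ultimately have half: "u = 1/2" "v = 1" using uv by linarith+
  have "len m y = 2 * len n x" using \<open>u * len m y = v * len n x\<close> unfolding half by simp
  then have "y $ 2 = 2 * x $ 2" "y $ 3 = 2 * x $ 3" using c l by auto
  then show False using x y by (auto simp: core_def)
qed

text \<open>
  For different second components, the images lie in two cells that share only the midpoint of \<open>e\<^sub>2\<close> and \<open>e\<^sub>3\<close>,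
  and that point is the image of a vertex outside the core.
\<close>

lemma branch_disjoint:
  assumes i: "i \<in> branches" and j: "j \<in> branches" and ne: "i \<noteq> j"
    and x: "x \<in> core" and y: "y \<in> core"
  shows "branch i x \<noteq> branch j y"
proof
  assume eq: "branch i x = branch j y"
  obtain n where n: "i = (n, 2) \<or> i = (n, 3)" "1 \<le> n" "n \<le> 40" using i by (rule branchesE)
  obtain m where m: "j = (m, 2) \<or> j = (m, 3)" "1 \<le> m" "m \<le> 40" using j by (rule branchesE)
  have mixed: False if eq: "branch (k, 2) x = branch (l, 3) y" and x: "x \<in> core" and y: "y \<in> core"
    and k: "1 \<le> k" "k \<le> 40" and l: "1 \<le> l" "l \<le> 40" for k l x y
  proof -
    note sx = coreD(1)[OF x] and sy = coreD(1)[OF y]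
    note sb = branch_in_simplex[OF sx, of "(k, 2)"]
    have L: "0 < len k x" using len_ge_1[OF sx, of k] by linarith
    have two: "1/2 \<le> branch (k, 2) x $ 2"
      using run_first_bounds(1)[OF x k] by (simp only: branch_nth(2)[OF sx])
    have three: "1/2 \<le> branch (k, 2) x $ 3"
      using run_first_bounds(1)[OF y l] by (simp only: eq branch_nth(6)[OF sy])
    have "branch (k, 2) x $ 1 = 0" "branch (k, 2) x $ 3 = 1/2"
      using two three simplexD(3)[OF sb] simplexD(1)[OF sb, of 1] by linarith+
    then have x2: "x $ 2 = 0" and x3: "2 * x $ 3 = len k x"
      using L by (auto simp: branch_nth[OF sx] field_simps)
    have "1 * (1 - x $ 1) \<le> real k * (1 - x $ 1)"
      using k simplexD(2)[OF sx, of 1] by (intro mult_right_mono) auto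
    then have "1 \<le> x $ 3" using x2 x3 simplexD(3)[OF sx] by (simp add: len_def)
    then show False using x by (simp add: core_def)
  qed
  have same: False if "branch (n, k) x = branch (m, k) y" "n \<noteq> m" for k
  proof -
    have "run n x = run m y"
      using arg_cong[OF that(1), of "relabel (Transposition.transpose 1 k)"]
      by (simp add: branch_def vec_eq_iff)
    then show False using run_disjoint[OF x y, of n m] run_disjoint[OF y x, of m n] that(2)
      by (metis linorder_neqE_nat)
  qed
  show False
    using n(1) m(1)
  proof (elim disjE)
    assume "i = (n, 2)" "j = (m, 2)" then show False using same[of 2] eq ne by auto
  next
    assume "i = (n, 3)" "j = (m, 3)" then show False using same[of 3] eq ne by auto
  next
    assume "i = (n, 2)" "j = (m, 3)" then show False using mixed[OF _ x y n(2,3) m(2,3)] eq by auto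
  next
    assume "i = (n, 3)" "j = (m, 2)" then show False using mixed[OF _ y x m(2,3) n(2,3)] eq by auto
  qed
qed

lemma continuous_on_branch: "continuous_on core (branch i)"
proof -
  have c: "continuous_on core (run n)" for n
  proof (induction n)
    case (Suc n)
    have "run n ` core \<subseteq> std_simplex" using run_in_simplex coreD(1) by blast
    then have "continuous_on core (rauzy_map 1 \<circ> run n)"
      using Suc continuous_on_subset[OF continuous_on_rauzy_map] by (intro continuous_on_compose) auto
    then show ?case by (simp add: run_def comp_def)
  qed (simp add: run_def)
  have "continuous_on core (relabel (Transposition.transpose 1 (snd i)) \<circ> run (fst i))"
    by (intro continuous_on_compose c continuous_on_relabel)
  then show ?thesis by (simp add: branch_def[abs_def] comp_def)
qed

lemma branch_separation:
  "\<exists>\<delta>>0. \<forall>i\<in>branches. \<forall>j\<in>branches. \<forall>x\<in>core. \<forall>y\<in>core. i \<noteq> j \<longrightarrow> \<delta> \<le> infnorm (branch i x - branch j y)"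
proof -
  define P where "P = {(i, j). i \<in> branches \<and> j \<in> branches \<and> i \<noteq> j}"
  have "P \<subseteq> branches \<times> branches" by (auto simp: P_def)
  then have fin: "finite P" by (rule finite_subset) (simp add: branches_def)
  have "\<exists>\<delta>>0. \<forall>x\<in>core. \<forall>y\<in>core. \<delta> \<le> infnorm (branch (fst p) x - branch (snd p) y)" if "p \<in> P" for p
  proof -
    let ?f = "\<lambda>z. infnorm (branch (fst p) (fst z) - branch (snd p) (snd z))"
    have "continuous_on (core \<times> core) ?f"
      by (intro continuous_on_infnorm continuous_on_diff
          continuous_on_compose2[OF continuous_on_branch] continuous_intros) auto
    moreover have "compact (core \<times> core)" "core \<times> core \<noteq> {}"
      using core_compact core_nonempty by (auto intro: compact_Times)
    ultimately have "\<exists>z\<in>core \<times> core. \<forall>z'\<in>core \<times> core. ?f z \<le> ?f z'"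
      by (intro continuous_attains_inf)
    then obtain z where z: "z \<in> core \<times> core" "\<forall>z'\<in>core \<times> core. ?f z \<le> ?f z'"
      by (elim bexE)
    have "0 < ?f z"
    proof -
      have "branch (fst p) (fst z) \<noteq> branch (snd p) (snd z)"
        using that z(1) by (intro branch_disjoint) (auto simp: P_def)
      then show ?thesis by (simp add: infnorm_pos_lt)
    qed
    moreover have "\<forall>x\<in>core. \<forall>y\<in>core. ?f z \<le> infnorm (branch (fst p) x - branch (snd p) y)"
    proof (intro ballI)
      fix x y assume "x \<in> core" "y \<in> core"
      then show "?f z \<le> infnorm (branch (fst p) x - branch (snd p) y)" using bspec[OF z(2), of "(x, y)"] by simp
    qed
    ultimately show ?thesis by blast
  qed
  then have "\<exists>D. \<forall>p\<in>P. 0 < D p \<and> (\<forall>x\<in>core. \<forall>y\<in>core. D p \<le> infnorm (branch (fst p) x - branch (snd p) y))"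
    by (intro bchoice ballI)
  then obtain D where D: "\<forall>p\<in>P. 0 < D p \<and> (\<forall>x\<in>core. \<forall>y\<in>core. D p \<le> infnorm (branch (fst p) x - branch (snd p) y))"
    by (rule exE)
  define \<delta> where "\<delta> = Min (insert 1 (D ` P))"
  have "0 < \<delta>" using fin D by (simp add: \<delta>_def)
  moreover have "\<delta> \<le> infnorm (branch i x - branch j y)"
    if "i \<in> branches" "j \<in> branches" "x \<in> core" "y \<in> core" "i \<noteq> j" for i j x y
  proof -
    have p: "(i, j) \<in> P" using that by (simp add: P_def)
    then have "\<delta> \<le> D (i, j)" using fin by (auto simp: \<delta>_def)
    also have "\<dots> \<le> infnorm (branch i x - branch j y)" using bspec[OF D p] that(3,4) by simp
    finally show ?thesis .
  qed
  ultimately show ?thesis by blast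
qed

section \<open>The transfer inequality\<close>

text \<open>
  Entry \<open>n - 1\<close> is the integer part of \<open>10 ^ 6\<close> times \<open>(1 + 17 * n / 20) powr (- 31/13)\<close>, the value of
  the power at the point of tangency \<open>u = 17/20\<close>.
\<close>

definition inverse_power_table :: "int list" where
  "inverse_power_table =
    [230620, 93618, 48743, 29215, 19173, 13405, 9821, 7459, 5828, 4661, 3799, 3147, 2644, 2247,
     1930, 1672, 1461, 1286, 1139, 1015, 909, 818, 740, 672, 612, 560, 513, 472, 436, 403, 374,
     348, 324, 302, 283, 265, 249, 234, 220, 207]"

definition node :: "nat \<Rightarrow> int" where
  "node n = 20 + 17 * int n"

text \<open>
  Divided by \<open>coeff_den n\<close>, these are the values at \<open>u = 1/2\<close> and at \<open>u = 1\<close> of the tangent at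
  \<open>u = 17/20\<close> to the \<open>n\<close>-th term of the transfer sum, relative to the power
  \<open>(1 + 17 * n / 20) powr (- 31/13)\<close>.
\<close>

definition left_coeff :: "nat \<Rightarrow> int" where
  "left_coeff n = 13 * (node n)\<^sup>2 + (217 * int n + 438) * node n - 6160"

definition right_coeff :: "nat \<Rightarrow> int" where
  "right_coeff n = 13 * (node n)\<^sup>2 + (128 - 93 * int n) * node n + 2640"

definition coeff_den :: "nat \<Rightarrow> int" where
  "coeff_den n = 13 * (node n)\<^sup>2"

lemma table_powers:
  "\<forall>n\<in>{1..40}. (inverse_power_table ! (n - 1)) ^ 13 * node n ^ 31 \<le> 10 ^ 78 * 20 ^ 31"
  unfolding inverse_power_table_def node_def by code_simp

lemma table_left:
  "10 ^ 6 \<le> (\<Sum>n=1..40. inverse_power_table ! (n - 1) * left_coeff n div coeff_den n)"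
  unfolding inverse_power_table_def left_coeff_def coeff_den_def node_def by code_simp

lemma table_right:
  "5 * 10 ^ 5 \<le> (\<Sum>n=1..40. inverse_power_table ! (n - 1) * right_coeff n div coeff_den n)"
  unfolding inverse_power_table_def right_coeff_def coeff_den_def node_def by code_simp

text \<open>
  The left-hand side is convex in \<open>t\<close> on \<open>t > 1\<close>, and the right-hand side is its tangent at \<open>s\<close>.
\<close>

lemma power_difference_tangent:
  fixes p c t s :: real
  assumes p: "0 < p" and pc: "p + 2 \<le> p * c" and t: "1 < t" and s: "1 < s"
  shows "c * t powr (-p) - t powr (-p - 1)
    \<ge> s powr (-p) * (c - 1 / s + ((p + 1) / s\<^sup>2 - p * c / s) * (t - s))"
proof -
  define f where "f = (\<lambda>t::real. c * t powr (-p) - t powr (-p - 1))"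
  define f' where "f' = (\<lambda>t::real. c * (-p * t powr (-p - 1)) - (-p - 1) * t powr (-p - 2))"
  define f'' where "f'' = (\<lambda>t::real. c * (-p * ((-p - 1) * t powr (-p - 2))) - (-p - 1) * ((-p - 2) * t powr (-p - 3)))"
  have d1: "(f has_real_derivative f' t) (at t)" if "t \<in> {1<..}" for t
    unfolding f_def f'_def using that
    by (auto intro!: derivative_eq_intros simp: algebra_simps)
  have d2: "(f' has_real_derivative f'' t) (at t)" if "t \<in> {1<..}" for t
    unfolding f'_def f''_def using that
    by (auto intro!: derivative_eq_intros simp: algebra_simps)
  have nonneg: "0 \<le> f'' t" if "t \<in> {1<..}" for t
  proof -
    have "t powr (-p - 2) = t powr (-p - 3) * t"
      using that powr_add[of t "-p - 3" 1] by (simp add: algebra_simps)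
    then have "f'' t = (p + 1) * t powr (-p - 3) * (p * c * t - (p + 2))"
      by (simp add: f''_def algebra_simps)
    moreover have "p + 2 \<le> p * c * t"
    proof -
      have "p * c * 1 \<le> p * c * t" using that p pc by (intro mult_left_mono) auto
      then show ?thesis using pc by linarith
    qed
    ultimately show ?thesis using p by simp
  qed
  have "convex_on {1<..} f"
    by (rule f''_ge0_imp_convex[OF _ d1 d2 nonneg]) auto
  then have "f' s * (t - s) \<le> f t - f s"
    using t s d1[of s]
    by (intro convex_on_imp_above_tangent[where A = "{1<..}"])
      (auto simp: interior_open intro: has_field_derivative_at_within)
  moreover have "f s = s powr (-p) * (c - 1 / s)"
    using s by (simp add: f_def powr_diff field_simps)
  moreover have "f' s = s powr (-p) * ((p + 1) / s\<^sup>2 - p * c / s)"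
    using s by (simp add: f'_def powr_diff powr_numeral field_simps)
  ultimately show ?thesis by (simp add: f_def algebra_simps)
qed

text \<open>
  With \<open>t = 1 + n * u\<close> the term is \<open>1 / n\<close> times \<open>(n + 1) * t powr (- p) - t powr (- p - 1)\<close>, which lies above
  its tangent at \<open>u = 17/20\<close>. The tangent is interpolated between its values at the ends of \<open>[1/2, 1]\<close>.
  Both values are nonnegative multiples of the tabulated power, so the rounded-down table entries and
  the integer divisions only decrease the bound.
\<close>

lemma transfer_term_bound:
  fixes u :: real
  assumes u: "1/2 \<le> u" "u \<le> 1" and n: "n \<in> {1..40}"
  shows "((2 - 2 * u) * real_of_int (inverse_power_table ! (n - 1) * left_coeff n div coeff_den n)
      + (2 * u - 1) * real_of_int (inverse_power_table ! (n - 1) * right_coeff n div coeff_den n)) / 10 ^ 6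
    \<le> (1 / (1 + real n * u)) powr (31/13) * (1 + u / (1 + real n * u))"
proof -
  define m where "m n = real_of_int (inverse_power_table ! (n - 1)) / 10 ^ 6" for n
  define s where "s = real_of_int (node n) / 20"
  define t where "t = 1 + real n * u"
  have n1: "1 \<le> real n" using n by simp
  have s: "1 < s" "s = 1 + 17 * real n / 20" using n1 by (auto simp: s_def node_def)
  have t: "1 < t" using n1 u by (simp add: t_def)
  have m_le: "m n \<le> s powr (-31/13)"
  proof (rule power_le_imp_le_base)
    have "real_of_int ((inverse_power_table ! (n - 1)) ^ 13 * (node n) ^ 31) \<le> real_of_int (10 ^ 78 * 20 ^ 31)"
      using table_powers n by (subst of_int_le_iff) blast
    moreover have "real_of_int (inverse_power_table ! (n - 1)) = 10 ^ 6 * m n" "real_of_int (node n) = 20 * s"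
      by (simp_all add: m_def s_def)
    ultimately have "(10 ^ 6 * m n) ^ 13 * (20 * s) ^ 31 \<le> 10 ^ 78 * 20 ^ 31"
      by (simp only: of_int_mult of_int_power of_int_numeral)
    moreover have "(10 ^ 6 * x) ^ 13 * (20 * y) ^ 31 = (x ^ 13 * y ^ 31) * (10 ^ 78 * 20 ^ 31)" for x y :: real
      by (simp add: power_mult_distrib)
    ultimately have "((m n) ^ 13 * s ^ 31) * (10 ^ 78 * 20 ^ 31) \<le> 1 * (10 ^ 78 * 20 ^ 31)"
      by (simp only: mult_1)
    then have "(m n) ^ 13 * s ^ 31 \<le> 1"
      by (rule mult_right_le_imp_le) simp
    then have "(m n) ^ 13 \<le> 1 / s ^ 31" using s(1) by (simp add: pos_le_divide_eq)
    also have "\<dots> = s powr (-31)" using s by (simp add: powr_minus_divide powr_numeral)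
    also have "\<dots> = (s powr (-31/13)) ^ Suc 12"
      using s by (simp add: powr_realpow[symmetric] powr_powr del: power_Suc)
    finally show "m n ^ Suc 12 \<le> (s powr (-31/13)) ^ Suc 12" by simp
  qed simp
  have Dpos: "0 < coeff_den n" by (simp add: coeff_den_def node_def)
  have Lnn: "0 \<le> left_coeff n"
  proof -
    have "438 * 20 \<le> (217 * int n + 438) * node n" by (intro mult_mono) (auto simp: node_def)
    moreover have "0 \<le> 13 * (node n)\<^sup>2" by simp
    ultimately show ?thesis unfolding left_coeff_def by linarith
  qed
  have Rnn: "0 \<le> right_coeff n"
    by (simp add: right_coeff_def node_def power2_eq_square algebra_simps)
  let ?slope = "(31/13 + 1) / s\<^sup>2 - 31/13 * (real n + 1) / s"
  have tangent: "s powr (-31/13) * (real n + 1 - 1 / s + ?slope * (t - s))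
    \<le> (real n + 1) * t powr (-31/13) - t powr (-31/13 - 1)"
    using power_difference_tangent[of "31/13" "real n + 1" t s] n1 s t by simp
  have "(real n + 1) * t powr (-31/13) - t powr (-31/13 - 1)
      = real n * ((1 / t) powr (31/13) * (1 + u / t))"
  proof -
    have "t powr (-31/13 - 1) = t powr (-31/13) / t"
      using t powr_diff[of t "-31/13" 1] by simp
    moreover have "(1 / t) powr (31/13) = t powr (-31/13)"
      using t by (simp add: powr_divide powr_minus_divide)
    moreover have "real n * (P * (1 + u / t)) = (real n + 1) * P - P / t" for P
    proof -
      have "real n * (P * (1 + u / t)) = real n * P + P * (real n * u / t)"
        by (simp add: algebra_simps)
      also have "real n * u / t = 1 - 1 / t"
      proof -
        have "real n * u = t - 1" by (simp add: t_def)
        then show ?thesis using t by (simp add: diff_divide_distrib)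
      qed
      finally show ?thesis by (simp add: algebra_simps)
    qed
    ultimately show ?thesis by simp
  qed
  moreover have "real n + 1 - 1 / s + ?slope * (t - s) = real n *
     ((2 - 2 * u) * (real_of_int (left_coeff n) / real_of_int (coeff_den n)) + (2 * u - 1) * (real_of_int (right_coeff n) / real_of_int (coeff_den n)))"
  proof -
    have ts: "t - s = real n * (u - 17/20)" by (simp add: t_def s(2) algebra_simps)
    have rT: "real_of_int (node n) = 20 * s" by (simp add: s_def)
    have nS: "17 * real n = 20 * s - 20" using s(2) by simp
    have s0: "s \<noteq> 0" using s by auto
    have n_eq: "real n = (20 * s - 20) / 17" using nS by simp
    show ?thesis
      unfolding ts left_coeff_def right_coeff_def coeff_den_def of_int_add of_int_diff of_int_mult of_int_power of_int_numeral rT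
        of_int_of_nat_eq n_eq
      using s0 by (simp add: field_simps power2_eq_square)
  qed
  ultimately have "s powr (-31/13) * (real n * ((2 - 2 * u) * (real_of_int (left_coeff n) / real_of_int (coeff_den n)) + (2 * u - 1) * (real_of_int (right_coeff n) / real_of_int (coeff_den n))))
    \<le> real n * ((1 / t) powr (31/13) * (1 + u / t))" using tangent by simp
  then have main: "s powr (-31/13) * ((2 - 2 * u) * (real_of_int (left_coeff n) / real_of_int (coeff_den n)) + (2 * u - 1) * (real_of_int (right_coeff n) / real_of_int (coeff_den n)))
    \<le> (1 / t) powr (31/13) * (1 + u / t)" using n1 by (simp add: mult.left_commute)
  have fl: "real_of_int (x div coeff_den n) \<le> real_of_int x / real_of_int (coeff_den n)" for x
    by (rule real_of_int_div4)
  have "((2 - 2 * u) * real_of_int (inverse_power_table ! (n - 1) * left_coeff n div coeff_den n)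
    + (2 * u - 1) * real_of_int (inverse_power_table ! (n - 1) * right_coeff n div coeff_den n)) / 10 ^ 6
    \<le> ((2 - 2 * u) * (real_of_int (inverse_power_table ! (n - 1) * left_coeff n) / real_of_int (coeff_den n))
    + (2 * u - 1) * (real_of_int (inverse_power_table ! (n - 1) * right_coeff n) / real_of_int (coeff_den n))) / 10 ^ 6"
    using u by (intro divide_right_mono add_mono mult_left_mono fl) auto
  also have "\<dots> = m n * ((2 - 2 * u) * (real_of_int (left_coeff n) / real_of_int (coeff_den n)) + (2 * u - 1) * (real_of_int (right_coeff n) / real_of_int (coeff_den n)))"
    by (simp add: m_def field_simps)
  also have "\<dots> \<le> s powr (-31/13) * ((2 - 2 * u) * (real_of_int (left_coeff n) / real_of_int (coeff_den n)) + (2 * u - 1) * (real_of_int (right_coeff n) / real_of_int (coeff_den n)))"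
    using m_le u Lnn Rnn Dpos by (intro mult_right_mono) auto
  also note main
  finally show ?thesis by (simp add: t_def)
qed

text \<open>
  The margin is small: the minimum over \<open>[1/2, 1]\<close> of the difference of the two sides is about 0.004, near
  \<open>u = 0.85\<close>. The difference is convex, so the sum of the tangents at a single well-chosen point suffices,
  and that sum only has to be compared with \<open>3/2 - u\<close> at the two ends.
\<close>

theorem transfer_inequality:
  fixes u :: real
  assumes u: "1/2 \<le> u" "u \<le> 1"
  shows "3/2 - u \<le> (\<Sum>n=1..40. (1 / (1 + real n * u)) powr (31/13) * (1 + u / (1 + real n * u)))"
proof -
  have left: "1 \<le> real_of_int (\<Sum>n=1..40. inverse_power_table ! (n - 1) * left_coeff n div coeff_den n) / 10 ^ 6"
  proof -
    have "real_of_int (10 ^ 6) \<le> real_of_int (\<Sum>n=1..40. inverse_power_table ! (n - 1) * left_coeff n div coeff_den n)"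
      unfolding of_int_le_iff by (rule table_left)
    then show ?thesis by simp
  qed
  have right: "1/2 \<le> real_of_int (\<Sum>n=1..40. inverse_power_table ! (n - 1) * right_coeff n div coeff_den n) / 10 ^ 6"
  proof -
    have "real_of_int (5 * 10 ^ 5) \<le> real_of_int (\<Sum>n=1..40. inverse_power_table ! (n - 1) * right_coeff n div coeff_den n)"
      unfolding of_int_le_iff by (rule table_right)
    then show ?thesis by simp
  qed
  have "3/2 - u = (2 - 2 * u) * 1 + (2 * u - 1) * (1/2)" by (simp add: algebra_simps)
  also have "\<dots> \<le> (2 - 2 * u) * (real_of_int (\<Sum>n=1..40. inverse_power_table ! (n - 1) * left_coeff n div coeff_den n) / 10 ^ 6)
      + (2 * u - 1) * (real_of_int (\<Sum>n=1..40. inverse_power_table ! (n - 1) * right_coeff n div coeff_den n) / 10 ^ 6)"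
    using u by (intro add_mono mult_left_mono left right) auto
  also have "\<dots> = (\<Sum>n=1..40. ((2 - 2 * u) * real_of_int (inverse_power_table ! (n - 1) * left_coeff n div coeff_den n)
      + (2 * u - 1) * real_of_int (inverse_power_table ! (n - 1) * right_coeff n div coeff_den n)) / 10 ^ 6)"
    by (simp add: sum.distrib sum_distrib_left sum_divide_distrib add_divide_distrib)
  also have "\<dots> \<le> (\<Sum>n=1..40. (1 / (1 + real n * u)) powr (31/13) * (1 + u / (1 + real n * u)))"
    by (rule sum_mono) (rule transfer_term_bound[OF u])
  finally show ?thesis .
qed

section \<open>Distortion and the dimension bound\<close>

abbreviation shrink :: "nat \<times> 3 \<Rightarrow> real^3 \<Rightarrow> real" where
  "shrink i x \<equiv> 1 / len (fst i) x"

text \<open>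
  An invariant of the column sums of the products of the matrices along a word. The triangle inequalities
  survive the addition of one column to the other two, and they are what bounds the two large columns
  by the one that was added last, whose sum is \<open>\<alpha>\<close>. Here \<open>42 = 40 + 2\<close> comes from the maximal length of a run.
\<close>

definition balanced :: "real \<Rightarrow> real \<Rightarrow> real \<Rightarrow> bool" where
  "balanced \<alpha> \<beta> \<gamma> \<longleftrightarrow> 0 < \<alpha> \<and> \<alpha> \<le> \<beta> \<and> \<alpha> \<le> \<gamma> \<and> \<beta> \<le> \<alpha> + \<gamma> \<and> \<gamma> \<le> \<alpha> + \<beta> \<and>
    \<beta> \<le> 42 * \<alpha> \<and> \<gamma> \<le> 42 * \<alpha>"

lemma balanced_step:
  assumes "balanced \<alpha> \<beta> \<gamma>" "1 \<le> n" "n \<le> (40::nat)"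
  shows "balanced \<beta> (\<alpha> + real n * \<beta>) (\<gamma> + real n * \<beta>)"
    "balanced \<gamma> (\<beta> + real n * \<gamma>) (\<alpha> + real n * \<gamma>)"
proof -
  have pos: "0 < \<beta>" "0 < \<gamma>" using assms(1) by (auto simp: balanced_def)
  have "1 * \<beta> \<le> real n * \<beta>" "real n * \<beta> \<le> 40 * \<beta>" "1 * \<gamma> \<le> real n * \<gamma>" "real n * \<gamma> \<le> 40 * \<gamma>"
    using assms(2,3) pos by (intro mult_right_mono; simp)+
  note step = this
  show "balanced \<beta> (\<alpha> + real n * \<beta>) (\<gamma> + real n * \<beta>)"
    using step assms(1) unfolding balanced_def by (elim conjE, intro conjI; linarith)
  show "balanced \<gamma> (\<beta> + real n * \<gamma>) (\<alpha> + real n * \<gamma>)"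
    using step assms(1) unfolding balanced_def by (elim conjE, intro conjI; linarith)
qed

lemma word_ratio_columns:
  assumes "set w \<subseteq> branches"
  shows "\<exists>\<alpha> \<beta> \<gamma>. balanced \<alpha> \<beta> \<gamma> \<and> (\<forall>x\<in>std_simplex.
    word_ratio branch shrink w x = 1 / (\<alpha> * x $ 1 + \<beta> * x $ 2 + \<gamma> * x $ 3))"
  using assms
proof (induction w rule: rev_induct)
  case Nil
  have "balanced 1 1 1" by (simp add: balanced_def)
  moreover have "word_ratio branch shrink [] x = 1 / (1 * x $ 1 + 1 * x $ 2 + 1 * x $ 3)"
    if "x \<in> std_simplex" for x
    using simplexD(3)[OF that] by simp
  ultimately show ?case by blast
next
  case (snoc i w)
  then obtain \<alpha> \<beta> \<gamma> where inv: "balanced \<alpha> \<beta> \<gamma>"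
    and w: "\<And>x. x \<in> std_simplex \<Longrightarrow>
      word_ratio branch shrink w x = 1 / (\<alpha> * x $ 1 + \<beta> * x $ 2 + \<gamma> * x $ 3)" by auto
  obtain n where n: "i = (n, 2) \<or> i = (n, 3)" "1 \<le> n" "n \<le> 40"
    using snoc.prems by (auto elim: branchesE)
  have ratio: "word_ratio branch shrink (w @ [i]) x
      = 1 / ((\<alpha> * branch i x $ 1 + \<beta> * branch i x $ 2 + \<gamma> * branch i x $ 3) * len n x)"
    if "x \<in> std_simplex" for x
    using n(1) w[OF branch_in_simplex[OF that], of i] by (auto simp: word_ratio_append)
  have l: "len n x \<noteq> 0" if "x \<in> std_simplex" for x
    using len_ge_1[OF that, of n] by linarith
  have u: "1 - x $ 1 = x $ 2 + x $ 3" if "x \<in> std_simplex" for x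
    using simplexD(3)[OF that] by simp
  from n(1) show ?case
  proof
    assume i: "i = (n, 2)"
    have "(\<alpha> * branch i x $ 1 + \<beta> * branch i x $ 2 + \<gamma> * branch i x $ 3) * len n x
        = \<beta> * x $ 1 + (\<alpha> + real n * \<beta>) * x $ 2 + (\<gamma> + real n * \<beta>) * x $ 3"
      if "x \<in> std_simplex" for x
      using l[OF that] by (simp add: i branch_nth[OF that] u[OF that] distrib_right) (simp add: algebra_simps)
    then show ?thesis using ratio balanced_step(1)[OF inv n(2,3)] by metis
  next
    assume i: "i = (n, 3)"
    have "(\<alpha> * branch i x $ 1 + \<beta> * branch i x $ 2 + \<gamma> * branch i x $ 3) * len n x
        = \<gamma> * x $ 1 + (\<beta> + real n * \<gamma>) * x $ 2 + (\<alpha> + real n * \<gamma>) * x $ 3"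
      if "x \<in> std_simplex" for x
      using l[OF that] by (simp add: i branch_nth[OF that] u[OF that] distrib_right) (simp add: algebra_simps)
    then show ?thesis using ratio balanced_step(2)[OF inv n(2,3)] by metis
  qed
qed

lemma word_ratio_distortion:
  assumes w: "set w \<subseteq> branches" and x: "x \<in> std_simplex" and y: "y \<in> std_simplex"
  shows "word_ratio branch shrink w x
    \<le> 42 * word_ratio branch shrink w y"
proof -
  obtain \<alpha> \<beta> \<gamma> where inv: "0 < \<alpha>" "\<alpha> \<le> \<beta>" "\<alpha> \<le> \<gamma>" "\<beta> \<le> 42 * \<alpha>" "\<gamma> \<le> 42 * \<alpha>"
    and eq: "\<And>x. x \<in> std_simplex \<Longrightarrow> word_ratio branch shrink w x
      = 1 / (\<alpha> * x $ 1 + \<beta> * x $ 2 + \<gamma> * x $ 3)"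
    using word_ratio_columns[OF w] unfolding balanced_def by blast
  have low: "\<alpha> \<le> \<alpha> * z $ 1 + \<beta> * z $ 2 + \<gamma> * z $ 3"
    and high: "\<alpha> * z $ 1 + \<beta> * z $ 2 + \<gamma> * z $ 3 \<le> 42 * \<alpha>" if z: "z \<in> std_simplex" for z
  proof -
    have one: "c * z $ 1 + c * z $ 2 + c * z $ 3 = c" for c
      using simplexD(3)[OF z] by (metis distrib_left mult.right_neutral)
    show "\<alpha> \<le> \<alpha> * z $ 1 + \<beta> * z $ 2 + \<gamma> * z $ 3"
      using mult_right_mono[OF inv(2) simplexD(1)[OF z, of 2]]
        mult_right_mono[OF inv(3) simplexD(1)[OF z, of 3]] one[of \<alpha>] by linarith
    have "\<alpha> * z $ 1 \<le> 42 * \<alpha> * z $ 1" using inv simplexD(1)[OF z, of 1] by (intro mult_right_mono) auto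
    then show "\<alpha> * z $ 1 + \<beta> * z $ 2 + \<gamma> * z $ 3 \<le> 42 * \<alpha>"
      using mult_right_mono[OF inv(4) simplexD(1)[OF z, of 2]]
        mult_right_mono[OF inv(5) simplexD(1)[OF z, of 3]] one[of "42 * \<alpha>"] by linarith
  qed
  have "word_ratio branch shrink w x \<le> 1 / \<alpha>"
    unfolding eq[OF x] using low[OF x] inv by (intro divide_left_mono) auto
  also have "\<dots> = 42 * (1 / (42 * \<alpha>))" by simp
  also have "\<dots> \<le> 42 * word_ratio branch shrink w y"
    unfolding eq[OF y] using low[OF y] high[OF y] inv by (intro mult_left_mono divide_left_mono) auto
  finally show ?thesis .
qed

text \<open>
  The affine function \<open>h x = 1/2 + x $ 1\<close> is close to an eigenfunction of the transfer operator. Being affine, it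
  has a sum over the two exchanges that depends on \<open>x\<close> only through \<open>u = 1 - x $ 1\<close>, which reduces subinvariance to
  an inequality in one variable.
\<close>

lemma branch_subinvariant:
  assumes x: "x \<in> core"
  shows "1/2 + x $ 1 \<le> (\<Sum>i\<in>branches. (1 / len (fst i) x) powr (31/13) * (1/2 + branch i x $ 1))"
proof -
  note s = coreD(1)[OF x]
  have u: "1/2 \<le> 1 - x $ 1" "1 - x $ 1 \<le> 1"
    using coreD(2)[OF x] simplexD(1)[OF s, of 1] by auto
  have "1/2 + x $ 1 = 3/2 - (1 - x $ 1)" by simp
  also have "\<dots> \<le> (\<Sum>n=1..40. (1 / len n x) powr (31/13) * (1 + (1 - x $ 1) / len n x))"
    using transfer_inequality[OF u] by (simp add: len_def)
  also have "\<dots> = (\<Sum>n=1..40. \<Sum>j\<in>{2,3}. (1 / len n x) powr (31/13) * (1/2 + branch (n, j) x $ 1))"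
  proof (rule sum.cong)
    fix n
    have "(1 - x $ 1) / len n x = branch (n, 2) x $ 1 + branch (n, 3) x $ 1"
      using simplexD(3)[OF s] by (simp add: branch_nth[OF s] add_divide_distrib[symmetric])
    then show "(1 / len n x) powr (31/13) * (1 + (1 - x $ 1) / len n x)
        = (\<Sum>j\<in>{2,3}. (1 / len n x) powr (31/13) * (1/2 + branch (n, j) x $ 1))"
      by (simp add: algebra_simps)
  qed simp
  also have "\<dots> = (\<Sum>i\<in>branches. (1 / len (fst i) x) powr (31/13) * (1/2 + branch i x $ 1))"
    unfolding branches_def sum.cartesian_product case_prod_beta by simp
  finally show ?thesis .
qed

lemma len_ge:
  assumes "i \<in> branches" "x \<in> core" shows "3/2 \<le> len (fst i) x"
proof -
  have "1 * (1/2) \<le> real (fst i) * (1 - x $ 1)"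
    using assms coreD(2)[OF assms(2)] by (intro mult_mono) (auto simp: branches_def)
  then show ?thesis by (simp add: len_def)
qed

theorem theorem1p2:
  shows "hausdorff_dim rauzy_gasket > ereal 1.19"
proof -
  obtain \<delta> where \<delta>: "0 < \<delta>" and sep: "\<And>i j x y. i \<in> branches \<Longrightarrow> j \<in> branches \<Longrightarrow> x \<in> core \<Longrightarrow>
      y \<in> core \<Longrightarrow> i \<noteq> j \<Longrightarrow> \<delta> \<le> infnorm (branch i x - branch j y)"
    using branch_separation by metis
  interpret weighted_ifs core branches branch shrink "\<lambda>x y. infnorm (x - y)"
    "\<lambda>x. 1/2 + x $ 1" "31/13" "2/3" 42 \<delta> "1/2" "3/2"
  proof
    show "0 < 1 / len (fst i) x" "1 / len (fst i) x \<le> 2/3" if "i \<in> branches" "x \<in> core" for i x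
      using len_ge[OF that] by (simp_all add: field_simps)
    show "infnorm (x - y) \<le> dist x y" for x y :: "real^3"
      by (simp add: dist_norm infnorm_le_norm)
    show "word_ratio branch shrink w x \<le> 42 * word_ratio branch shrink w y"
      if "set w \<subseteq> branches" "x \<in> core" "y \<in> core" for w x y
      using that by (intro word_ratio_distortion coreD(1))
    show "1/2 \<le> 1/2 + x $ 1" "1/2 + x $ 1 \<le> 3/2" if "x \<in> core" for x
      using simplexD(1,2)[OF coreD(1)[OF that], of 1] by simp_all
  qed (use core_compact core_nonempty branch_core branch_expansion coreD(1) \<delta> sep branch_subinvariant
      in \<open>auto simp: branches_def\<close>)
  have "ereal (31/13 / 2) \<le> hausdorff_dim core"
    using finite_cover_bound by (intro hausdorff_dim_ge_of_finite_cover_bound[OF core_compact _ c0_pos]) auto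
  also have "\<dots> \<le> hausdorff_dim rauzy_gasket"
    by (rule hausdorff_dim_mono) (auto simp: core_def)
  finally have "ereal (31/26) \<le> hausdorff_dim rauzy_gasket" by simp
  moreover have "ereal 1.19 < ereal (31/26)" by simp
  ultimately show ?thesis by (rule less_le_trans[rotated])
qed

end
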